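(* Let $f:\mathbb{R}^d\to\mathbb{R}$ be $L$-smooth with $L>0$ and bounded below, with $f^\star=\inf_x f(x)>-\infty$. Let the stochastic gradients $\nabla F(x;\xi)$, $\xi\sim\mathcal{D}$, satisfy, for some $p\in(1,2]$ and $\sigma\ge 0$, $\mathbb{E}[\nabla F(x;\xi)]=\nabla f(x)$ and $\mathbb{E}\big[\|\nabla F(x;\xi)-\nabla f(x)\|^p\big]\le\sigma^p$ for all $x\in\mathbb{R}^d$. Let $x_0\in\mathbb{R}^d$, $\Delta=f(x_0)-f^\star>0$ and $\epsilon>0$. Put $$\alpha=\min\left\{1,\left(\frac{\epsilon}{3\cdot 2^{\frac{p+1}{p}}\sigma}\right)^{\frac{p}{p-1}}\right\}$$ (with $\alpha=1$ if $\sigma=0$). Run RANSGDm (the algorithm described in the context) from $x_0$ with $$R=\left\lceil\frac1\alpha\right\rceil,\qquad \eta=\frac{\alpha\epsilon}{24L},\qquad \beta=1-\alpha,\qquad K=\left\lceil\frac{72L\Delta}{\alpha\epsilon^2}\right\rceil .$$ Then its output $\hat x$ satisfies $\mathbb{E}\|\nabla f(\hat x)\|\le\epsilon$.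
   Context: $f(x)=\mathbb{E}_{\xi\sim\mathcal{D}}[F(x;\xi)]$ is the objective. $L$-smooth means $\|\nabla f(x)-\nabla f(y)\|\le L\|x-y\|$ for all $x,y\in\mathbb{R}^d$. $\|\cdot\|$ is the Euclidean norm. Algorithm RANSGDm (one server, $n$ workers). Inputs: delay threshold $R\in\mathbb{N}$, stepsize $\eta>0$, momentum parameter $\beta\in[0,1)$, iteration number $K\in\mathbb{N}$. Each worker $i\in\{1,\dots,n\}$ repeats forever: request data from the server; receive the server's current pair $(x_k,k)$; draw a fresh sample $\xi_{k,i}\sim\mathcal{D}$; compute $\nabla F(x_k;\xi_{k,i})$; send $(\nabla F(x_k;\xi_{k,i}),k)$ to the server. The server starts with $x_0\in\mathbb{R}^d$, $v_0=0$, $k=0$. While $k<K$: upon a data request it sends $(x_k,k)$; upon receiving a pair $(g,\iota)$ it sets $\delta_k=k-\iota$, and if $\delta_k<R$ it writes $g_k:=g$ and performs $$v_{k+1}=\beta_k v_k+(1-\beta)g_k,\qquad x_{k+1}=x_k-\eta\,\frac{v_{k+1}}{\|v_{k+1}\|},\qquad \beta_k=\begin{cases}0,&k\le 1,\\ \beta,&k>1,\end{cases}$$ and increments $k$ by one; if $\delta_k\ge R$ the received gradient is discarded. The output $\hat x$ is drawn uniformly at random from $\{x_0,\dots,x_{K-1}\}$. Thus the accepted gradient at round $k$ is $g_k=\nabla F(x_{k-\delta_k};\xi_{k-\delta_k})$ with $0\le\delta_k<R$, $\delta_k\le k$, where $\xi_{k-\delta_k}$ denotes the sample used by the sending worker.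 Conventions: all samples drawn by the workers are independent with law $\mathcal{D}$, each is used in at most one accepted update, and the computation times and order of arrivals (hence the delays $\delta_k$ and which gradients are accepted) do not depend on the sampled values; $v/\|v\|$ is read as $0$ if $v=0$. *)

theory Defs
  imports "HOL-Probability.Probability"
begin

text \<open>
  \<open>iter\<close> is the server's counter \<open>k\<close>, \<open>iterate j\<close> is \<open>x\<^sub>j\<close> for \<open>j \<le> k\<close> (so the server's
  current point is \<open>iterate k\<close>), and \<open>momentum\<close> is \<open>v\<^sub>k\<close>.  For a worker \<open>i\<close>, \<open>job i\<close> is
  \<open>Some (g, \<iota>)\<close> if the server has sent \<open>(x\<^sub>\<iota>, \<iota>)\<close> to \<open>i\<close> and the stochastic gradient \<open>g\<close>
  computed by \<open>i\<close> from it has not yet arrived, and \<open>None\<close> if the next message from \<open>i\<close> is a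
  data request.
\<close>

record 'a state =
  iter :: nat
  iterate :: "nat \<Rightarrow> 'a"
  momentum :: 'a
  job :: "nat \<Rightarrow> ('a \<times> nat) option"

definition initial_state :: "'a::real_normed_vector \<Rightarrow> 'a state" where
  "initial_state x0 = \<lparr>iter = 0, iterate = (\<lambda>_. x0), momentum = 0, job = (\<lambda>_. None)\<rparr>"

text \<open>If \<open>v = 0\<close>, then \<open>v /\<^sub>R norm v = 0\<close>, because \<open>inverse 0 = 0\<close>.\<close>

definition server_update ::
  "real \<Rightarrow> real \<Rightarrow> 'a::real_normed_vector \<Rightarrow> 'a state \<Rightarrow> 'a state" where
  "server_update \<eta> \<beta> g S =
    (let k = iter S;
         v = (if k \<le> 1 then 0 else \<beta>) *\<^sub>R momentum S + (1 - \<beta>) *\<^sub>R g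
     in S\<lparr>iter := Suc k,
          iterate := (iterate S)(Suc k := iterate S k - \<eta> *\<^sub>R (v /\<^sub>R norm v)),
          momentum := v\<rparr>)"

text \<open>
  One message from worker \<open>i\<close> reaches the server.  A worker alternates between data requests and
  gradients, so \<open>job\<close> tells which of the two the message is.  On a request, \<open>\<xi>\<close> is the
  sample that the worker draws for the data it receives; on the arrival of a gradient \<open>\<xi>\<close> is
  ignored.  Nothing happens any more once \<open>K\<close> updates have been made.
\<close>

definition process_message ::
  "('a \<Rightarrow> 's \<Rightarrow> 'a) \<Rightarrow> nat \<Rightarrow> real \<Rightarrow> real \<Rightarrow> nat \<Rightarrow> nat \<Rightarrow> 's
    \<Rightarrow> 'a::real_normed_vector state \<Rightarrow> 'a state" where
  "process_message G R \<eta> \<beta> K i \<xi> S =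
    (if iter S < K then
       (case job S i of
          None \<Rightarrow> S\<lparr>job := (job S)(i \<mapsto> (G (iterate S (iter S)) \<xi>, iter S))\<rparr>
        | Some (g, \<iota>) \<Rightarrow>
            (let S' = S\<lparr>job := (job S)(i := None)\<rparr>
             in if iter S - \<iota> < R then server_update \<eta> \<beta> g S' else S'))
     else S)"

text \<open>
  \<open>worker t\<close> is the sender of the \<open>t\<close>-th message and \<open>s t\<close> is the sample attached to that
  message, so that distinct requests use distinct coordinates of \<open>s\<close>.
\<close>

primrec run ::
  "('a \<Rightarrow> 's \<Rightarrow> 'a) \<Rightarrow> 'a \<Rightarrow> nat \<Rightarrow> real \<Rightarrow> real \<Rightarrow> nat \<Rightarrow> (nat \<Rightarrow> nat) \<Rightarrow> (nat \<Rightarrow> 's) \<Rightarrow> nat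
    \<Rightarrow> 'a::real_normed_vector state" where
  "run G x0 R \<eta> \<beta> K worker s 0 = initial_state x0"
| "run G x0 R \<eta> \<beta> K worker s (Suc t) =
     process_message G R \<eta> \<beta> K (worker t) (s t) (run G x0 R \<eta> \<beta> K worker s t)"

definition final_state ::
  "('a \<Rightarrow> 's \<Rightarrow> 'a) \<Rightarrow> 'a \<Rightarrow> nat \<Rightarrow> real \<Rightarrow> real \<Rightarrow> nat \<Rightarrow> (nat \<Rightarrow> nat) \<Rightarrow> (nat \<Rightarrow> 's)
    \<Rightarrow> 'a::real_normed_vector state" where
  "final_state G x0 R \<eta> \<beta> K worker s =
    run G x0 R \<eta> \<beta> K worker s (LEAST T. iter (run G x0 R \<eta> \<beta> K worker s T) = K)"

text \<open>
  The randomness of a run: independent samples with law \<open>D\<close>, and, independent of them, the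
  index of the returned iterate, uniform on \<open>{0, \<dots>, K - 1}\<close>.
\<close>

definition ransgdm_space :: "'s measure \<Rightarrow> nat \<Rightarrow> ((nat \<Rightarrow> 's) \<times> nat) measure" where
  "ransgdm_space D K = (\<Pi>\<^sub>M t\<in>(UNIV::nat set). D) \<Otimes>\<^sub>M measure_pmf (pmf_of_set {..<K})"

definition ransgdm_output ::
  "('a \<Rightarrow> 's \<Rightarrow> 'a) \<Rightarrow> 'a \<Rightarrow> nat \<Rightarrow> real \<Rightarrow> real \<Rightarrow> nat \<Rightarrow> (nat \<Rightarrow> nat) \<Rightarrow> (nat \<Rightarrow> 's) \<times> nat
    \<Rightarrow> 'a::real_normed_vector" where
  "ransgdm_output G x0 R \<eta> \<beta> K worker = (\<lambda>(s, j). iterate (final_state G x0 R \<eta> \<beta> K worker s) j)"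

text \<open>
  With finitely many workers every run makes \<open>K\<close> updates, so the \<open>LEAST\<close> in
  \<open>final_state\<close> is never vacuous: if the counter stopped at \<open>k < K\<close>, some worker would
  request \<open>(x\<^sub>k, k)\<close> and later deliver a gradient of delay \<open>0\<close>.
\<close>

lemma iter_process_message:
  "iter (process_message G R \<eta> \<beta> K i \<xi> S) = iter S \<or>
   iter (process_message G R \<eta> \<beta> K i \<xi> S) = Suc (iter S) \<and> iter S < K"
  by (auto simp: process_message_def server_update_def Let_def split: option.split)

lemma job_process_message_other:
  "j \<noteq> i \<Longrightarrow> job (process_message G R \<eta> \<beta> K i \<xi> S) j = job S j"
  by (auto simp: process_message_def server_update_def Let_def split: option.split)

lemma run_terminates:
  fixes worker :: "nat \<Rightarrow> nat"
  assumes worker: "\<And>t. worker t \<in> {1..n}" and "0 < R"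
  shows "\<exists>T. iter (run G x0 R \<eta> \<beta> K worker s T) = K"
proof (rule ccontr)
  let ?S = "run G x0 R \<eta> \<beta> K worker s"
  assume never: "\<not> ?thesis"
  have step: "iter (?S (Suc t)) = iter (?S t) \<or>
      iter (?S (Suc t)) = Suc (iter (?S t)) \<and> iter (?S t) < K" for t
    unfolding run.simps by (rule iter_process_message)
  have less: "iter (?S t) < K" for t
  proof (induction t)
    case 0
    have "iter (?S 0) \<noteq> K" using never by blast
    then show ?case by (simp add: initial_state_def)
  next
    case (Suc t)
    have "iter (?S (Suc t)) \<noteq> K" using never by blast
    then show ?case using Suc step[of t] by linarith
  qed
  have mono: "iter (?S t) \<le> iter (?S u)" if "t \<le> u" for t u
  proof (rule lift_Suc_mono_le[OF _ that])
    show "iter (?S t) \<le> iter (?S (Suc t))" for t using step[of t] by linarith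
  qed
  define k where "k = Max (range (\<lambda>t. iter (?S t)))"
  have fin: "finite (range (\<lambda>t. iter (?S t)))"
    by (rule finite_subset[of _ "{..<K}"]) (use less in auto)
  have "k \<in> range (\<lambda>t. iter (?S t))" unfolding k_def using fin by (intro Max_in) auto
  then obtain T where T: "iter (?S T) = k" by auto
  have const: "iter (?S t) = k" if "T \<le> t" for t
    using mono[OF that] T Max_ge[OF fin, of "iter (?S t)"] unfolding k_def[symmetric] by auto
  have "finite (range worker)" by (rule finite_subset[of _ "{1..n}"]) (use worker in auto)
  then obtain t0 where inf: "infinite {t. worker t = worker t0}"
    using pigeonhole_infinite[of UNIV worker] by auto
  define i where "i = worker t0"
  define next_msg where "next_msg t = (LEAST u. t \<le> u \<and> worker u = i)" for t
  have ex: "\<exists>u. t \<le> u \<and> worker u = i" for t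
    using inf unfolding i_def infinite_nat_iff_unbounded_le by auto
  have next_msg: "t \<le> next_msg t" "worker (next_msg t) = i" for t
    using LeastI_ex[OF ex[of t]] unfolding next_msg_def by auto
  have keep: "job (?S u) i = job (?S t) i" if "t \<le> u" "u \<le> next_msg t" for t u
    using that
  proof (induction u rule: dec_induct)
    case (step u)
    then have "i \<noteq> worker u"
      using not_less_Least[of u "\<lambda>u. t \<le> u \<and> worker u = i"] unfolding next_msg_def by auto
    then show ?case using step by (simp add: job_process_message_other)
  qed simp
  have request: "\<exists>g. job (?S (Suc (next_msg t))) i = Some (g, k)"
    if "T \<le> t" "job (?S t) i = None" for t
    using const[of "next_msg t"] next_msg[of t] keep[of t "next_msg t"] that less[of "next_msg t"]
    by (auto simp: process_message_def)
  have deliver: "job (?S (Suc (next_msg t))) i = None"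
    if "T \<le> t" "job (?S t) i \<noteq> None" for t
    using next_msg[of t] keep[of t "next_msg t"] that less[of "next_msg t"]
    by (auto simp: process_message_def server_update_def Let_def)
  have no_fresh: False if "T \<le> t" "job (?S t) i = Some (g, k)" for t g
    using const[of "next_msg t"] const[of "Suc (next_msg t)"] next_msg[of t]
      keep[of t "next_msg t"] that less[of "next_msg t"] \<open>0 < R\<close>
    by (auto simp: process_message_def server_update_def Let_def)
  have no_idle: False if "T \<le> t" "job (?S t) i = None" for t
    using request[OF that] no_fresh[of "Suc (next_msg t)"] that(1) next_msg(1)[of t] by auto
  show False
    using no_idle[of T] deliver[of T] no_idle[of "Suc (next_msg T)"] next_msg(1)[of T]
    by (meson le_Suc_eq le_refl le_SucI)
qed

end

theory Submission
  imports Defs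
begin

text \<open>
  Descent along a normalised direction \<open>v\<close> costs twice the error of \<open>v\<close> as an estimate of the
  gradient (\<open>normalised_step_descent\<close>), so the average gradient norm is bounded by
  \<open>\<Delta> / (\<eta> K) + L \<eta> / 2\<close> plus twice the average of these errors.  The momentum recursion is linear,
  and the error splits into a part that is bounded along every trajectory and a part due to noise.

  Along every trajectory, consecutive iterates are at distance at most \<open>\<eta>\<close>, because the steps are
  normalised.  Hence a gradient that is fewer than \<open>R\<close> updates old differs from the current one by at most
  \<open>L \<eta> (R - 1)\<close>, averaging adds at most \<open>L \<eta> (1 - \<alpha>) / \<alpha>\<close>, and the bias of the early averages
  dies out geometrically (\<open>momentum_of_stale_gradients\<close>).

  For the noise, the gradients are taken in the order in which they are accepted.  That
  order is deterministic (\<open>run_eq_accepted_updates\<close>, \<open>iterate_final_state\<close>).  The point at which an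
  accepted gradient was computed depends only on gradients accepted even earlier, and its sample on
  none of them, so the noise is a sequence of martingale differences although the
  samples were drawn in another order.  The inequality \<open>norm_add_powr_le\<close> then gives the
  \<open>p\<close>-th moment bound \<open>2 \<alpha>\<^bsup>p-1\<^esup> \<sigma>\<^bsup>p\<^esup>\<close> for its momentum averages (\<open>averaged_noise_moment\<close>), which by the choice
  of \<open>\<alpha>\<close> is at most \<open>(\<epsilon> / 6)\<^bsup>p\<^esup>\<close>.

  With the given parameters these contributions sum up to at most \<open>\<epsilon>\<close>, provided that
  \<open>\<epsilon>\<^sup>2 \<le> 8 L \<Delta>\<close> (\<open>gradient_sum_budget\<close>).  The proviso is needed for the bias of the early averages,
  which is not negligible if \<open>K\<close> is small compared with \<open>1 / \<alpha>\<close>.  In the remaining case,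
  \<open>\<epsilon>\<close> is so large that all iterates have gradients of norm at most \<open>\<epsilon>\<close> (\<open>small_gradients_budget\<close>).
\<close>

section \<open>An upper bound on powers of the norm\<close>

text \<open>
  Solved for \<open>b powr p\<close>, this is the tangent bound of the convex map \<open>t \<mapsto> t powr p\<close> at \<open>r\<close>.  In the
  present form it is Young's inequality for the product \<open>r powr (p - 1) * b\<close>, and it is needed both
  for the geometry of the norm and for passing from \<open>p\<close>-th moments to means.
\<close>

lemma powr_tangent_convex:
  fixes b r :: real
  assumes "1 < p" "0 \<le> b" "0 \<le> r"
  shows "p * (r powr (p - 1) * b) \<le> b powr p + (p - 1) * r powr p"
proof -
  define q where "q = p / (p - 1)"
  have q: "1 < q" "1 / p + 1 / q = 1" "(p - 1) * q = p"
    using assms(1) by (simp_all add: q_def field_simps)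
  have "b * r powr (p - 1) \<le> b powr p / p + (r powr (p - 1)) powr q / q"
    using assms q by (intro Youngs_inequality) auto
  also have "\<dots> = b powr p / p + r powr p * ((p - 1) / p)"
    using q(3) by (simp add: powr_powr) (simp add: q_def)
  finally have "p * (b * r powr (p - 1)) \<le> p * (b powr p / p + r powr p * ((p - 1) / p))"
    using assms(1) by (intro mult_left_mono) auto
  also have "\<dots> = b powr p + (p - 1) * r powr p"
    using assms(1) by (simp add: field_simps)
  finally show ?thesis by (simp add: mult.commute)
qed

lemma powr_tangent_concave:
  fixes s t :: real
  assumes "0 < c" "c \<le> 1" "0 \<le> t" "0 < s"
  shows "t powr c \<le> s powr c + c * s powr (c - 1) * (t - s)"
proof (cases "t = 0")
  case True
  have "s powr (c - 1) * s = s powr c"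
    using powr_add[of s "c - 1" 1] assms by simp
  then have "s powr c + c * s powr (c - 1) * (t - s) = (1 - c) * s powr c"
    using True by (simp add: algebra_simps)
  then show ?thesis using True assms by simp
next
  case False
  have "t powr c * s powr (1 - c) \<le> c * t + (1 - c) * s"
    using assms False by (intro Youngs_inequality_0) auto
  then have "t powr c * s powr (1 - c) * s powr (c - 1) \<le> (c * t + (1 - c) * s) * s powr (c - 1)"
    by (intro mult_right_mono) auto
  also have "(c * t + (1 - c) * s) * s powr (c - 1) = c * s powr (c - 1) * (t - s) + s powr (c - 1) * s"
    by (simp add: algebra_simps)
  also have "s powr (c - 1) * s = s powr c"
    using powr_add[of s "c - 1" 1] assms by simp
  also have "t powr c * s powr (1 - c) * s powr (c - 1) = t powr c"
    using powr_add[of s "1 - c" "c - 1"] assms by (simp add: mult.assoc)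
  finally show ?thesis by simp
qed

text \<open>
  The map \<open>t \<mapsto> t powr (p / 2)\<close> is concave, so \<open>(norm v)\<^sup>2 powr (p / 2)\<close> lies below its tangent
  at \<open>(norm c)\<^sup>2\<close>.  Squared norms are what an inner product expands exactly.
\<close>

lemma norm_powr_le_tangent:
  fixes v c :: "'a::real_inner"
  assumes "1 < p" "p \<le> 2" "c \<noteq> 0"
  shows "norm v powr p
    \<le> norm c powr p + p / 2 * norm c powr (p - 2) * (norm v^2 - norm c^2)"
proof -
  have sq: "((norm w)\<^sup>2) powr s = norm w powr (2 * s)" for w :: 'a and s
    using powr_powr[of "norm w" 2 s] by simp
  have "((norm v)\<^sup>2) powr (p / 2) \<le> ((norm c)\<^sup>2) powr (p / 2)
      + p / 2 * ((norm c)\<^sup>2) powr (p / 2 - 1) * ((norm v)\<^sup>2 - (norm c)\<^sup>2)"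
    using assms by (intro powr_tangent_concave) auto
  then show ?thesis unfolding sq by simp
qed

text \<open>
  This inequality is the substitute for the expansion of \<open>(norm (a + b))\<^sup>2\<close> when \<open>p < 2\<close>: its middle
  term is linear in \<open>b\<close> and vanishes in expectation when \<open>b\<close> is centred, so that \<open>p\<close>-th moments of
  sums of martingale differences add up to within the factor \<open>2\<close>.  If \<open>b\<close> is the shorter vector,
  it follows from the tangent at \<open>a\<close>; if \<open>b\<close> is longer, from the tangent at \<open>b\<close>, where the
  wrong coefficient of \<open>a \<bullet> b\<close> is corrected with the Cauchy-Schwarz and Young inequalities.
\<close>

lemma norm_add_powr_le:
  fixes a b :: "'a::real_inner"
  assumes p: "1 < p" "p \<le> 2"
  shows "norm (a + b) powr p
    \<le> norm a powr p + p * norm a powr (p - 2) * (a \<bullet> b) + 2 * norm b powr p"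
proof (cases "a = 0 \<or> b = 0")
  case True
  then show ?thesis by auto
next
  case False
  define r where "r = norm a"
  define t where "t = norm b"
  have pos: "0 < r" "0 < t" using False by (auto simp: r_def t_def)
  have expand: "norm (a + b)^2 = r^2 + 2 * (a \<bullet> b) + t^2"
    by (simp add: r_def t_def power2_norm_eq_inner inner_add_left inner_add_right inner_commute)
  have split: "u powr (p - 2) * u^2 = u powr p" "u powr (p - 2) * u = u powr (p - 1)" if "0 < u" for u
    using that powr_add[of u "p - 2" 2] powr_add[of u "p - 2" 1] by auto
  show ?thesis
  proof (cases "t \<le> r")
    case True
    have "norm (a + b) powr p \<le> r powr p + p / 2 * r powr (p - 2) * (norm (a + b)^2 - r^2)"
      unfolding r_def using False p by (intro norm_powr_le_tangent) auto
    also have "\<dots> = r powr p + p * r powr (p - 2) * (a \<bullet> b) + p / 2 * (r powr (p - 2) * t^2)"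
      unfolding expand by (simp add: algebra_simps)
    also have "p / 2 * (r powr (p - 2) * t^2) \<le> 1 * (t powr (p - 2) * t^2)"
      using p pos True by (intro mult_mono powr_mono2') auto
    also have "\<dots> \<le> 2 * t powr p" using split[OF pos(2)] by simp
    finally show ?thesis by (simp add: r_def t_def)
  next
    case False
    then have "r \<le> t" by simp
    have "norm (a + b) powr p \<le> t powr p + p / 2 * t powr (p - 2) * (norm (a + b)^2 - t^2)"
      unfolding t_def using \<open>\<not> (a = 0 \<or> b = 0)\<close> p by (intro norm_powr_le_tangent) auto
    also have "\<dots> = t powr p + p / 2 * (t powr (p - 2) * r^2) + p * t powr (p - 2) * (a \<bullet> b)"
      unfolding expand by (simp add: algebra_simps)
    finally have main: "norm (a + b) powr p
      \<le> t powr p + p / 2 * (t powr (p - 2) * r^2) + p * t powr (p - 2) * (a \<bullet> b)" .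
    have "0 \<le> r powr (p - 2) - t powr (p - 2)"
      using p pos \<open>r \<le> t\<close> by (simp add: powr_mono2')
    moreover have "- (a \<bullet> b) \<le> r * t"
      using norm_cauchy_schwarz[of "- a" b] by (simp add: r_def t_def)
    ultimately have "(r powr (p - 2) - t powr (p - 2)) * (- (a \<bullet> b))
        \<le> (r powr (p - 2) - t powr (p - 2)) * (r * t)"
      by (rule mult_left_mono[rotated])
    also have "\<dots> = (r powr (p - 2) * r) * t - (t powr (p - 2) * t) * r" by (simp add: algebra_simps)
    also have "\<dots> = r powr (p - 1) * t - t powr (p - 1) * r"
      using split(2)[OF pos(1)] split(2)[OF pos(2)] by simp
    finally have cross: "p * ((r powr (p - 2) - t powr (p - 2)) * (- (a \<bullet> b)))
        \<le> p * (r powr (p - 1) * t) - p * (t powr (p - 1) * r)"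
      using p mult_left_mono[of _ _ p] by (simp only: right_diff_distrib[symmetric])
    have young: "p * (r powr (p - 1) * t) \<le> t powr p + (p - 1) * r powr p"
      using p pos by (intro powr_tangent_convex) auto
    have "t powr (p - 2) * r * r \<le> t powr (p - 2) * t * r"
      using pos \<open>r \<le> t\<close> by (intro mult_left_mono mult_right_mono) auto
    then have "p * (t powr (p - 2) * r^2) \<le> p * (t powr (p - 1) * r)"
      using p pos split(2)[OF pos(2)] by (simp add: power2_eq_square mult.assoc[symmetric])
    moreover have "0 \<le> p * (t powr (p - 2) * r^2)" using p by simp
    ultimately have quad: "p / 2 * (t powr (p - 2) * r^2) \<le> p * (t powr (p - 1) * r)" by linarith
    have "(p - 1) * r powr p \<le> r powr p" using p by (simp add: mult_left_le_one_le)
    with main cross young quad show ?thesis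
      unfolding r_def[symmetric] t_def[symmetric] by (simp add: algebra_simps)
  qed
qed

section \<open>Descent along normalised steps\<close>

locale smooth_objective =
  fixes f :: "'a::euclidean_space \<Rightarrow> real" and gradf :: "'a \<Rightarrow> 'a" and L :: real
  assumes gradient: "GDERIV f x :> gradf x"
    and L_pos: "0 < L"
    and smooth: "norm (gradf x - gradf y) \<le> L * norm (x - y)"
    and bounded_below: "bdd_below (range f)"
begin

lemma quadratic_upper_bound: "f (x + h) \<le> f x + gradf x \<bullet> h + L / 2 * norm h^2"
proof -
  \<comment> \<open>The gap between \<open>f\<close> along the segment and its quadratic model decreases.\<close>
  define \<phi> where "\<phi> t = f (x + t *\<^sub>R h) - t * (gradf x \<bullet> h) - L / 2 * t^2 * norm h^2" for t
  have "\<phi> 1 \<le> \<phi> 0"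
  proof (rule DERIV_nonpos_imp_nonincreasing[of 0 1 \<phi>])
    fix t :: real
    assume t: "0 \<le> t" "t \<le> 1"
    have "((\<lambda>t. f (x + t *\<^sub>R h)) has_derivative (\<lambda>s. (s *\<^sub>R h) \<bullet> gradf (x + t *\<^sub>R h))) (at t)"
      by (rule has_derivative_compose[of "\<lambda>t. x + t *\<^sub>R h" "\<lambda>s. s *\<^sub>R h" t UNIV f "\<lambda>k. k \<bullet> gradf (x + t *\<^sub>R h)"])
         (use gradient[unfolded gderiv_def] in \<open>auto intro!: derivative_eq_intros\<close>)
    then have "((\<lambda>t. f (x + t *\<^sub>R h)) has_real_derivative (gradf (x + t *\<^sub>R h) \<bullet> h)) (at t)"
      by (simp add: has_field_derivative_def inner_commute mult_commute_abs)
    then have "(\<phi> has_real_derivative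
        (gradf (x + t *\<^sub>R h) \<bullet> h - gradf x \<bullet> h - L * t * norm h^2)) (at t)"
      unfolding \<phi>_def by (auto intro!: derivative_eq_intros)
    moreover have "(gradf (x + t *\<^sub>R h) - gradf x) \<bullet> h \<le> L * t * norm h^2"
    proof -
      have "(gradf (x + t *\<^sub>R h) - gradf x) \<bullet> h \<le> norm (gradf (x + t *\<^sub>R h) - gradf x) * norm h"
        by (rule norm_cauchy_schwarz)
      also have "\<dots> \<le> (L * norm (x + t *\<^sub>R h - x)) * norm h"
        by (intro mult_right_mono smooth) auto
      also have "\<dots> = L * t * norm h^2" using t by (simp add: power2_eq_square)
      finally show ?thesis .
    qed
    ultimately show "\<exists>y. (\<phi> has_real_derivative y) (at t) \<and> y \<le> 0"
      by (auto simp: inner_diff_left)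
  qed simp
  then show ?thesis by (simp add: \<phi>_def)
qed

lemma norm_gradient_sq_le: "norm (gradf x)^2 \<le> 2 * L * (f x - (INF y. f y))"
proof -
  \<comment> \<open>A gradient step of length \<open>1 / L\<close> cannot get below the infimum.\<close>
  have "(INF y. f y) \<le> f (x + (- (1 / L)) *\<^sub>R gradf x)"
    using bounded_below by (intro cINF_lower) auto
  also have "\<dots> \<le> f x + gradf x \<bullet> ((- (1 / L)) *\<^sub>R gradf x)
      + L / 2 * norm ((- (1 / L)) *\<^sub>R gradf x)^2"
    by (rule quadratic_upper_bound)
  also have "\<dots> = f x - norm (gradf x)^2 / (2 * L)"
    using L_pos by (simp add: power_mult_distrib dot_square_norm field_simps power2_eq_square)
  finally show ?thesis using L_pos by (simp add: field_simps)
qed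

text \<open>
  The vector \<open>sgn v\<close> is the normalised \<open>v\<close>, with value \<open>0\<close> at \<open>v = 0\<close>.  Normalisation makes the
  guaranteed decrease proportional to \<open>norm (gradf x)\<close> itself and bounds the length of every
  step by \<open>\<eta>\<close> whatever the noise, at the price of twice the error of the direction \<open>v\<close>.
\<close>

lemma normalised_step_descent:
  assumes "0 \<le> \<eta>"
  shows "f (x - \<eta> *\<^sub>R sgn v)
    \<le> f x - \<eta> * norm (gradf x) + 2 * \<eta> * norm (v - gradf x) + L / 2 * \<eta>^2"
proof -
  have sgn: "v \<bullet> sgn v = norm v" "norm (sgn v) \<le> 1"
    by (cases "v = 0"; simp add: sgn_div_norm dot_square_norm power2_eq_square)
       (simp add: norm_sgn)
  have "(v - gradf x) \<bullet> sgn v \<le> norm (v - gradf x) * norm (sgn v)"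
    by (rule norm_cauchy_schwarz)
  also have "\<dots> \<le> norm (v - gradf x) * 1" using sgn by (intro mult_left_mono) auto
  finally have "norm v - norm (v - gradf x) \<le> gradf x \<bullet> sgn v"
    using sgn by (simp add: inner_diff_left)
  moreover have "norm (gradf x) \<le> norm v + norm (v - gradf x)"
    using norm_triangle_sub[of "gradf x" v] by (simp add: norm_minus_commute)
  ultimately have "norm (gradf x) - 2 * norm (v - gradf x) \<le> gradf x \<bullet> sgn v" by linarith
  then have "\<eta> * (norm (gradf x) - 2 * norm (v - gradf x)) \<le> \<eta> * (gradf x \<bullet> sgn v)"
    using assms by (rule mult_left_mono)
  moreover have "L / 2 * norm ((- \<eta>) *\<^sub>R sgn v)^2 \<le> L / 2 * \<eta>^2"
    using assms sgn L_pos by (intro mult_left_mono power_mono) (auto intro: mult_left_le)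
  moreover have "f (x - \<eta> *\<^sub>R sgn v) \<le> f x + gradf x \<bullet> ((- \<eta>) *\<^sub>R sgn v) + L / 2 * norm ((- \<eta>) *\<^sub>R sgn v)^2"
    using quadratic_upper_bound[of x "(- \<eta>) *\<^sub>R sgn v"] by simp
  ultimately show ?thesis by (simp add: algebra_simps)
qed

end

section \<open>Momentum averages of stale gradients\<close>

text \<open>
  The momentum recursion as an operator on the sequence of incoming vectors.  It is linear, which
  lets the true gradients and the noise be averaged separately.  The coefficient of the past is
  \<open>0\<close> for \<open>k \<le> 1\<close>, so the weights at index \<open>Suc k\<close> add up to \<open>1 - \<beta> ^ k\<close> if \<open>k \<ge> 1\<close>.
\<close>

primrec momentum_of :: "real \<Rightarrow> (nat \<Rightarrow> 'a::real_vector) \<Rightarrow> nat \<Rightarrow> 'a" where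
  "momentum_of \<beta> g 0 = 0"
| "momentum_of \<beta> g (Suc k) = (if k \<le> 1 then 0 else \<beta>) *\<^sub>R momentum_of \<beta> g k + (1 - \<beta>) *\<^sub>R g k"

lemma momentum_of_add:
  "momentum_of \<beta> (\<lambda>j. g j + h j) k = momentum_of \<beta> g k + momentum_of \<beta> h k"
  by (induction k) (auto simp: algebra_simps)

lemma momentum_of_cong:
  "(\<And>j. j < k \<Longrightarrow> g j = h j) \<Longrightarrow> momentum_of \<beta> g k = momentum_of \<beta> h k"
  by (induction k) auto

text \<open>
  The weights of a momentum average fall short of \<open>1\<close> by the summands on the left.  In total, the
  shortfall is worth at most \<open>1 / \<alpha>\<close> rounds.
\<close>

lemma sum_initial_bias_le:
  fixes \<alpha> :: real
  assumes "0 < \<alpha>" "\<alpha> \<le> 1"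
  shows "(\<Sum>k<K. (1 - \<alpha>) ^ max k 1) \<le> 1 / \<alpha>"
proof -
  have "(\<Sum>k<K. (1 - \<alpha>) ^ max k 1) \<le> (\<Sum>k<Suc K. (1 - \<alpha>) ^ max k 1)"
    using assms by (intro sum_mono2) auto
  also have "\<dots> = (1 - \<alpha>) + (\<Sum>k<K. (1 - \<alpha>) ^ Suc k)"
    by (subst sum.lessThan_Suc_shift) simp
  also have "(\<Sum>k<K. (1 - \<alpha>) ^ Suc k) = (1 - \<alpha>) * (\<Sum>k<K. (1 - \<alpha>) ^ k)"
    by (simp add: sum_distrib_left)
  also have "(\<Sum>k<K. (1 - \<alpha>) ^ k) = (1 - (1 - \<alpha>) ^ K) / \<alpha>"
    using assms by (simp add: sum_gp_strict)
  also have "(1 - \<alpha>) * \<dots> \<le> (1 - \<alpha>) * (1 / \<alpha>)"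
    using assms by (intro mult_left_mono divide_right_mono) auto
  also have "(1 - \<alpha>) + (1 - \<alpha>) * (1 / \<alpha>) \<le> 1 / \<alpha>"
    using assms by (simp add: field_simps)
  finally show ?thesis by simp
qed

context smooth_objective
begin

lemma gradient_drift:
  assumes step: "\<And>k. norm (x (Suc k) - x k) \<le> \<eta>" and "j \<le> k"
  shows "norm (gradf (x j) - gradf (x k)) \<le> L * \<eta> * (real k - real j)"
proof -
  have "norm (x k - x j) \<le> \<eta> * (real k - real j)"
    using \<open>j \<le> k\<close>
  proof (induction k rule: dec_induct)
    case (step k)
    have "norm (x (Suc k) - x j) \<le> norm (x (Suc k) - x k) + norm (x k - x j)"
      using norm_triangle_ineq[of "x (Suc k) - x k" "x k - x j"] by simp
    then show ?case using step assms(1)[of k] by (simp add: algebra_simps)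
  qed simp
  then have "L * norm (x j - x k) \<le> L * (\<eta> * (real k - real j))"
    using L_pos by (simp add: norm_minus_commute)
  then show ?thesis using smooth[of "x j" "x k"] by simp
qed

text \<open>
  The three terms are the missing weight of the early averages, the staleness of the gradients
  (every accepted one is at most \<open>R - 1\<close> steps of length \<open>\<eta>\<close> old), and the lag of the average
  itself.  The last two form the fixed point of the recursion
  \<open>c \<mapsto> (1 - \<alpha>) * (c + L * \<eta>) + \<alpha> * (L * \<eta> * (R - 1))\<close> that the error satisfies.
\<close>

lemma momentum_of_stale_gradients:
  fixes x :: "nat \<Rightarrow> 'a"
  assumes step: "\<And>k. norm (x (Suc k) - x k) \<le> \<eta>"
    and \<alpha>: "0 < \<alpha>" "\<alpha> \<le> 1"
    and delay: "\<And>j. j \<le> k \<Longrightarrow> \<iota> j \<le> j \<and> j - \<iota> j < R"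
  shows "norm (momentum_of (1 - \<alpha>) (\<lambda>j. gradf (x (\<iota> j))) (Suc k) - gradf (x k))
    \<le> (1 - \<alpha>) ^ max k 1 * norm (gradf (x 0)) + L * \<eta> * (real R - 1) + L * \<eta> * (1 - \<alpha>) / \<alpha>"
proof -
  have \<eta>: "0 \<le> \<eta>" using step[of 0] norm_ge_zero order_trans by blast
  show ?thesis
    using delay
  proof (induction k)
    define m where "m = momentum_of (1 - \<alpha>) (\<lambda>j. gradf (x (\<iota> j)))"
    case 0
    from 0[of 0] have "\<iota> 0 = 0" "1 \<le> R" by auto
    then have "m (Suc 0) - gradf (x 0) = - ((1 - \<alpha>) *\<^sub>R gradf (x 0))"
      by (simp add: m_def algebra_simps)
    then have "norm (m (Suc 0) - gradf (x 0)) = (1 - \<alpha>) * norm (gradf (x 0))"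
      using \<alpha> by simp
    moreover have "0 \<le> L * \<eta> * (real R - 1)" "0 \<le> L * \<eta> * (1 - \<alpha>) / \<alpha>"
      using L_pos \<eta> \<alpha> \<open>1 \<le> R\<close> by auto
    ultimately show ?case by (simp add: m_def)
  next
    case (Suc k)
    define m where "m = momentum_of (1 - \<alpha>) (\<lambda>j. gradf (x (\<iota> j)))"
    let ?k = "Suc k" and ?B = "L * \<eta> * (1 - \<alpha>) / \<alpha>" and ?G = "norm (gradf (x 0))"
    have delay: "\<iota> ?k \<le> ?k" "real ?k - real (\<iota> ?k) \<le> real R - 1" "1 \<le> R"
      using Suc.prems[of ?k] by (auto simp flip: of_nat_diff)
    have "norm (gradf (x (\<iota> ?k)) - gradf (x ?k)) \<le> L * \<eta> * (real ?k - real (\<iota> ?k))"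
      using gradient_drift[of x \<eta> "\<iota> ?k" ?k] step delay(1) by simp
    also have "\<dots> \<le> L * \<eta> * (real R - 1)" using L_pos \<eta> delay by (intro mult_left_mono) auto
    finally have stale: "norm (gradf (x (\<iota> ?k)) - gradf (x ?k)) \<le> L * \<eta> * (real R - 1)" .
    have last: "norm (gradf (x k) - gradf (x ?k)) \<le> L * \<eta>"
      using gradient_drift[of x \<eta> k ?k] step by simp
    have fix_point: "(1 - \<alpha>) * (?B + L * \<eta>) = ?B" using \<alpha> by (simp add: field_simps)
    have combine: "norm (m (Suc ?k) - gradf (x ?k)) \<le> (1 - \<alpha>) * (c + L * \<eta>) + \<alpha> * (L * \<eta> * (real R - 1))"
      if "m (Suc ?k) = (1 - \<alpha>) *\<^sub>R w + \<alpha> *\<^sub>R gradf (x (\<iota> ?k))" "norm (w - gradf (x k)) \<le> c" for w c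
    proof -
      have "m (Suc ?k) - gradf (x ?k) = (1 - \<alpha>) *\<^sub>R ((w - gradf (x k)) + (gradf (x k) - gradf (x ?k)))
          + \<alpha> *\<^sub>R (gradf (x (\<iota> ?k)) - gradf (x ?k))"
        unfolding that(1) by (simp add: algebra_simps)
      also have "norm \<dots> \<le> (1 - \<alpha>) * norm ((w - gradf (x k)) + (gradf (x k) - gradf (x ?k)))
          + \<alpha> * norm (gradf (x (\<iota> ?k)) - gradf (x ?k))"
        using \<alpha> by (intro norm_triangle_le) simp
      also have "\<dots> \<le> (1 - \<alpha>) * (c + L * \<eta>) + \<alpha> * (L * \<eta> * (real R - 1))"
        using \<alpha> stale last that(2) by (intro add_mono mult_left_mono norm_triangle_le) auto
      finally show ?thesis .
    qed
    have RB: "0 \<le> (1 - \<alpha>) * (L * \<eta> * (real R - 1))" "0 \<le> (1 - \<alpha>) * ?B"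
      using L_pos \<eta> \<alpha> delay(3) by auto
    have "norm (m (Suc ?k) - gradf (x ?k)) \<le> (1 - \<alpha>) ^ max ?k 1 * ?G + L * \<eta> * (real R - 1) + ?B"
    proof (cases "k = 0")
      case True
      \<comment> \<open>The past is dropped here, as if the previous average were \<open>0\<close>.\<close>
      then have "m (Suc ?k) = (1 - \<alpha>) *\<^sub>R 0 + \<alpha> *\<^sub>R gradf (x (\<iota> ?k))"
        by (simp add: m_def)
      from combine[OF this, of ?G] True
      have "norm (m (Suc ?k) - gradf (x ?k)) \<le> (1 - \<alpha>) * (?G + L * \<eta>) + \<alpha> * (L * \<eta> * (real R - 1))"
        by simp
      then show ?thesis using fix_point RB True by (simp add: algebra_simps)
    next
      case False
      then have "m (Suc ?k) = (1 - \<alpha>) *\<^sub>R m (Suc k) + \<alpha> *\<^sub>R gradf (x (\<iota> ?k))"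
        by (simp add: m_def)
      moreover have "max k (Suc 0) = k" using False by simp
      ultimately have "norm (m (Suc ?k) - gradf (x ?k))
          \<le> (1 - \<alpha>) * ((1 - \<alpha>) ^ k * ?G + L * \<eta> * (real R - 1) + ?B + L * \<eta>) + \<alpha> * (L * \<eta> * (real R - 1))"
        using combine[OF _ Suc.IH[folded m_def]] Suc.prems by simp
      also have "\<dots> = (1 - \<alpha>) * (1 - \<alpha>) ^ k * ?G + L * \<eta> * (real R - 1) + (1 - \<alpha>) * (?B + L * \<eta>)"
        by (simp add: algebra_simps)
      finally show ?thesis using fix_point False by (simp add: max_def)
    qed
    then show ?case by (simp add: m_def)
  qed
qed

text \<open>
  Summing the one-step descent over all rounds telescopes the objective values.  The statement
  concerns a single trajectory; of the noise \<open>e\<close> it keeps only the norms of its momentum averages.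
\<close>

lemma sum_gradient_norms_le:
  fixes x e :: "nat \<Rightarrow> 'a"
  assumes move: "\<And>k. x (Suc k) =
      x k - \<eta> *\<^sub>R sgn (momentum_of (1 - \<alpha>) (\<lambda>j. gradf (x (\<iota> j)) + e j) (Suc k))"
    and "0 \<le> \<eta>" and \<alpha>: "0 < \<alpha>" "\<alpha> \<le> 1"
    and delay: "\<And>j. j < K \<Longrightarrow> \<iota> j \<le> j \<and> j - \<iota> j < R"
  shows "\<eta> * (\<Sum>k<K. norm (gradf (x k))) \<le> (f (x 0) - (INF y. f y))
    + 2 * \<eta> * (\<Sum>k<K. norm (momentum_of (1 - \<alpha>) e (Suc k)))
    + 2 * \<eta> * norm (gradf (x 0)) / \<alpha>
    + K * (2 * \<eta> * (L * \<eta> * (real R - 1) + L * \<eta> * (1 - \<alpha>) / \<alpha>) + L / 2 * \<eta>^2)"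
proof -
  let ?N = "\<lambda>k. norm (momentum_of (1 - \<alpha>) e (Suc k))" and ?G = "norm (gradf (x 0))"
  let ?B = "L * \<eta> * (real R - 1) + L * \<eta> * (1 - \<alpha>) / \<alpha>"
  have step: "norm (x (Suc k) - x k) \<le> \<eta>" for k
    unfolding move[of k] using \<open>0 \<le> \<eta>\<close> by (simp add: norm_sgn)
  have one: "\<eta> * norm (gradf (x k)) \<le> f (x k) - f (x (Suc k))
      + 2 * \<eta> * ?N k + 2 * \<eta> * ?G * (1 - \<alpha>) ^ max k 1 + (2 * \<eta> * ?B + L / 2 * \<eta>^2)" if "k < K" for k
  proof -
    let ?m = "momentum_of (1 - \<alpha>) (\<lambda>j. gradf (x (\<iota> j))) (Suc k)"
    let ?v = "momentum_of (1 - \<alpha>) (\<lambda>j. gradf (x (\<iota> j)) + e j) (Suc k)"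
    have "norm (?v - gradf (x k)) \<le> norm (?m - gradf (x k)) + ?N k"
      unfolding momentum_of_add
      using norm_triangle_ineq[of "?m - gradf (x k)" "momentum_of (1 - \<alpha>) e (Suc k)"]
      by (simp add: algebra_simps)
    also have "norm (?m - gradf (x k)) \<le> (1 - \<alpha>) ^ max k 1 * ?G + L * \<eta> * (real R - 1) + L * \<eta> * (1 - \<alpha>) / \<alpha>"
      using that delay by (intro momentum_of_stale_gradients[where x = x and \<eta> = \<eta> and \<iota> = \<iota>] step \<alpha>) auto
    finally have "2 * \<eta> * norm (?v - gradf (x k)) \<le> 2 * \<eta> * ((1 - \<alpha>) ^ max k 1 * ?G + ?B + ?N k)"
      using \<open>0 \<le> \<eta>\<close> by (intro mult_left_mono) auto
    moreover have "f (x (Suc k)) \<le> f (x k) - \<eta> * norm (gradf (x k))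
        + 2 * \<eta> * norm (?v - gradf (x k)) + L / 2 * \<eta>^2"
      unfolding move[of k] by (rule normalised_step_descent[OF \<open>0 \<le> \<eta>\<close>])
    ultimately show ?thesis by (simp add: algebra_simps)
  qed
  have "\<eta> * (\<Sum>k<K. norm (gradf (x k))) \<le> (\<Sum>k<K. f (x k) - f (x (Suc k))
      + 2 * \<eta> * ?N k + 2 * \<eta> * ?G * (1 - \<alpha>) ^ max k 1 + (2 * \<eta> * ?B + L / 2 * \<eta>^2))"
    unfolding sum_distrib_left by (intro sum_mono one) simp
  also have "\<dots> = (f (x 0) - f (x K)) + 2 * \<eta> * (\<Sum>k<K. ?N k)
      + 2 * \<eta> * ?G * (\<Sum>k<K. (1 - \<alpha>) ^ max k 1) + K * (2 * \<eta> * ?B + L / 2 * \<eta>^2)"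
    by (simp add: sum.distrib sum_distrib_left sum_lessThan_telescope'[of "\<lambda>k. f (x k)"])
  also have "\<dots> \<le> (f (x 0) - (INF y. f y)) + 2 * \<eta> * (\<Sum>k<K. ?N k)
      + 2 * \<eta> * ?G * (1 / \<alpha>) + K * (2 * \<eta> * ?B + L / 2 * \<eta>^2)"
    using \<open>0 \<le> \<eta>\<close> bounded_below sum_initial_bias_le[OF \<alpha>, of K]
    by (intro add_mono order_refl mult_left_mono diff_left_mono cINF_lower) auto
  finally show ?thesis by simp
qed

end

section \<open>The order of arrivals\<close>

text \<open>
  The combinatorial shadow of a run: gradients are replaced by the index of the message whose
  sample they use and the index of the iterate they are computed at.  It evolves without reference
  to the sampled values, so which samples are accepted, and in which order, is deterministic.
  The update number \<open>k\<close> uses the sample \<open>sample k\<close> at the iterate \<open>version k\<close>.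
\<close>

record schedule =
  accepted :: nat
  pending :: "nat \<Rightarrow> (nat \<times> nat) option"
  sample :: "nat \<Rightarrow> nat"
  version :: "nat \<Rightarrow> nat"

definition initial_schedule :: schedule where
  "initial_schedule = \<lparr>accepted = 0, pending = (\<lambda>_. None), sample = (\<lambda>_. 0), version = (\<lambda>_. 0)\<rparr>"

definition schedule_message :: "nat \<Rightarrow> nat \<Rightarrow> nat \<Rightarrow> nat \<Rightarrow> schedule \<Rightarrow> schedule" where
  "schedule_message R K i t Z =
    (if accepted Z < K then
       (case pending Z i of
          None \<Rightarrow> Z\<lparr>pending := (pending Z)(i \<mapsto> (t, accepted Z))\<rparr>
        | Some (u, \<iota>) \<Rightarrow>
            (let Z' = Z\<lparr>pending := (pending Z)(i := None)\<rparr>; k = accepted Z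
             in if k - \<iota> < R
                then Z'\<lparr>accepted := Suc k, sample := (sample Z)(k := u), version := (version Z)(k := \<iota>)\<rparr>
                else Z'))
     else Z)"

primrec schedule_run :: "nat \<Rightarrow> nat \<Rightarrow> (nat \<Rightarrow> nat) \<Rightarrow> nat \<Rightarrow> schedule" where
  "schedule_run R K worker 0 = initial_schedule"
| "schedule_run R K worker (Suc t) = schedule_message R K (worker t) t (schedule_run R K worker t)"

text \<open>
  The invariant behind independence: every sample index occurs in at most one place, either in one
  pending job or in one accepted update, and all indices in use belong to past messages.
\<close>

definition valid_schedule :: "nat \<Rightarrow> nat \<Rightarrow> schedule \<Rightarrow> bool" where
  "valid_schedule R t Z \<longleftrightarrow>
    (\<forall>i u \<iota>. pending Z i = Some (u, \<iota>) \<longrightarrow> u < t \<and> \<iota> \<le> accepted Z) \<and>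
    (\<forall>k < accepted Z. sample Z k < t \<and> version Z k \<le> k \<and> k - version Z k < R) \<and>
    (\<forall>i j u \<iota> \<kappa>. pending Z i = Some (u, \<iota>) \<longrightarrow> pending Z j = Some (u, \<kappa>) \<longrightarrow> i = j) \<and>
    (\<forall>i u \<iota>. pending Z i = Some (u, \<iota>) \<longrightarrow> (\<forall>k < accepted Z. sample Z k \<noteq> u)) \<and>
    inj_on (sample Z) {..<accepted Z}"

lemma valid_schedule_message:
  assumes "valid_schedule R t Z"
  shows "valid_schedule R (Suc t) (schedule_message R K i t Z)"
proof (cases "accepted Z < K")
  case False
  then show ?thesis using assms
    unfolding valid_schedule_def schedule_message_def by (auto simp: less_Suc_eq)
next
  case True
  note Z = assms[unfolded valid_schedule_def]
  show ?thesis
  proof (cases "pending Z i")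
    case None
    with True have "schedule_message R K i t Z = Z\<lparr>pending := (pending Z)(i \<mapsto> (t, accepted Z))\<rparr>"
      by (simp add: schedule_message_def)
    with Z show ?thesis unfolding valid_schedule_def by (auto simp: less_Suc_eq; fastforce)
  next
    case (Some m)
    obtain u \<iota> where m: "m = (u, \<iota>)" by (cases m)
    show ?thesis
    proof (cases "accepted Z - \<iota> < R")
      case False
      with True Some m have "schedule_message R K i t Z = Z\<lparr>pending := (pending Z)(i := None)\<rparr>"
        by (simp add: schedule_message_def)
      with Z show ?thesis unfolding valid_schedule_def by (auto simp: less_Suc_eq)
    next
      case accept: True
      let ?k = "accepted Z"
      have message: "schedule_message R K i t Z = Z\<lparr>pending := (pending Z)(i := None),
          accepted := Suc ?k, sample := (sample Z)(?k := u), version := (version Z)(?k := \<iota>)\<rparr>"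
        using True Some m accept by (simp add: schedule_message_def Let_def)
      have p: "pending Z i = Some (u, \<iota>)" using Some m by simp
      with Z have u: "u < t" "\<iota> \<le> ?k" "\<forall>k < ?k. sample Z k \<noteq> u" by blast+
      have others: "v \<noteq> u" if "j \<noteq> i" "pending Z j = Some (v, \<kappa>)" for j v \<kappa>
        using Z p that by blast
      have "inj_on ((sample Z)(?k := u)) {..<Suc ?k}"
        using Z u(3) by (auto simp: inj_on_def less_Suc_eq)
      moreover have "\<forall>j v \<kappa>. j \<noteq> i \<longrightarrow> pending Z j = Some (v, \<kappa>) \<longrightarrow>
          (\<forall>k < Suc ?k. ((sample Z)(?k := u)) k \<noteq> v)"
        using Z others by (auto simp: less_Suc_eq)
      ultimately show ?thesis unfolding message valid_schedule_def
        using Z u accept by (auto simp: less_Suc_eq le_SucI split: if_splits)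
    qed
  qed
qed

lemma valid_schedule_run: "valid_schedule R t (schedule_run R K worker t)"
proof (induction t)
  case 0
  show ?case by (simp add: initial_schedule_def valid_schedule_def)
next
  case (Suc t)
  then show ?case by (simp add: valid_schedule_message)
qed

text \<open>
  The run seen by the server only: discarded gradients, requests and workers are gone, and
  \<open>\<tau>\<close> and \<open>\<iota>\<close> name the sample and the iterate behind each accepted gradient.  The \<open>job\<close> field of
  these states keeps its initial value.
\<close>

primrec accepted_updates ::
  "('a \<Rightarrow> 's \<Rightarrow> 'a) \<Rightarrow> 'a \<Rightarrow> real \<Rightarrow> real \<Rightarrow> (nat \<Rightarrow> nat) \<Rightarrow> (nat \<Rightarrow> nat) \<Rightarrow> (nat \<Rightarrow> 's) \<Rightarrow> nat
    \<Rightarrow> 'a::real_normed_vector state" where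
  "accepted_updates G x0 \<eta> \<beta> \<tau> \<iota> s 0 = initial_state x0"
| "accepted_updates G x0 \<eta> \<beta> \<tau> \<iota> s (Suc k) =
    (let S = accepted_updates G x0 \<eta> \<beta> \<tau> \<iota> s k
     in server_update \<eta> \<beta> (G (iterate S (\<iota> k)) (s (\<tau> k))) S)"

lemma accepted_updates_cong:
  assumes "\<And>j. j < k \<Longrightarrow> \<iota> j = \<iota>' j" "\<And>j. j < k \<Longrightarrow> s (\<tau> j) = s' (\<tau>' j)"
  shows "accepted_updates G x0 \<eta> \<beta> \<tau> \<iota> s k = accepted_updates G x0 \<eta> \<beta> \<tau>' \<iota>' s' k"
  using assms by (induction k) auto

lemma iter_accepted_updates: "iter (accepted_updates G x0 \<eta> \<beta> \<tau> \<iota> s k) = k"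
  by (induction k) (auto simp: initial_state_def server_update_def Let_def)

lemma server_update_job: "server_update \<eta> \<beta> g (S\<lparr>job := q\<rparr>) = (server_update \<eta> \<beta> g S)\<lparr>job := q\<rparr>"
  by (simp add: server_update_def Let_def)

lemma iterate_server_update:
  "j \<le> iter S \<Longrightarrow> iterate (server_update \<eta> \<beta> g S) j = iterate S j"
  by (simp add: server_update_def Let_def)

lemma iterate_accepted_updates:
  "j \<le> k \<Longrightarrow> iterate (accepted_updates G x0 \<eta> \<beta> \<tau> \<iota> s k) j
    = iterate (accepted_updates G x0 \<eta> \<beta> \<tau> \<iota> s j) j"
proof (induction k rule: dec_induct)
  case (step k)
  then show ?case by (simp add: Let_def iterate_server_update iter_accepted_updates)
qed simp

text \<open>
  The gradients in transit, reconstructed from their entries in the schedule.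
\<close>

definition jobs_of ::
  "('a \<Rightarrow> 's \<Rightarrow> 'a) \<Rightarrow> (nat \<Rightarrow> 's) \<Rightarrow> (nat \<Rightarrow> 'a) \<Rightarrow> (nat \<Rightarrow> (nat \<times> nat) option)
    \<Rightarrow> nat \<Rightarrow> ('a \<times> nat) option" where
  "jobs_of G s X q i = map_option (\<lambda>(u, \<iota>). (G (X \<iota>) (s u), \<iota>)) (q i)"

text \<open>
  Induction on the messages.  An accepted update \<open>k\<close> only writes the iterate \<open>Suc k\<close>, whereas the
  pending gradients were computed at iterates up to \<open>k\<close>, and it extends the record of samples and
  versions without changing the entries below \<open>k\<close>.  Hence neither the pending gradients nor the
  earlier updates are affected.
\<close>

lemma run_eq_accepted_updates:
  fixes G :: "'a::real_normed_vector \<Rightarrow> 's \<Rightarrow> 'a" and x0 \<eta> \<beta> worker R K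
  defines "Z \<equiv> schedule_run R K worker"
  defines "U \<equiv> \<lambda>s t. accepted_updates G x0 \<eta> \<beta> (sample (Z t)) (version (Z t)) s (accepted (Z t))"
  shows "run G x0 R \<eta> \<beta> K worker s t
    = (U s t)\<lparr>job := jobs_of G s (iterate (U s t)) (pending (Z t))\<rparr>"
proof (induction t)
  case 0
  show ?case by (simp add: U_def Z_def initial_schedule_def initial_state_def jobs_of_def fun_eq_iff)
next
  case (Suc t)
  let ?i = "worker t" and ?k = "accepted (Z t)" and ?S = "run G x0 R \<eta> \<beta> K worker s t"
  have valid: "valid_schedule R t (Z t)" unfolding Z_def by (rule valid_schedule_run)
  have Z_Suc: "Z (Suc t) = schedule_message R K ?i t (Z t)" by (simp add: Z_def)
  have iter: "iter ?S = ?k" using Suc by (simp add: U_def iter_accepted_updates)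
  have job: "job ?S = jobs_of G s (iterate (U s t)) (pending (Z t))" using Suc by simp
  show ?case
  proof (cases "?k < K")
    case False
    then have "Z (Suc t) = Z t" by (simp add: Z_Suc schedule_message_def)
    moreover from this have "U s (Suc t) = U s t" by (simp add: U_def)
    ultimately show ?thesis using False Suc iter by (simp add: process_message_def)
  next
    case less: True
    show ?thesis
    proof (cases "pending (Z t) ?i")
      case None
      then have Z': "Z (Suc t) = (Z t)\<lparr>pending := (pending (Z t))(?i \<mapsto> (t, ?k))\<rparr>"
        using less by (simp add: Z_Suc schedule_message_def)
      then have U': "U s (Suc t) = U s t" by (simp add: U_def)
      have "job ?S ?i = None" using None by (simp add: job jobs_of_def)
      then have "run G x0 R \<eta> \<beta> K worker s (Suc t)
          = ?S\<lparr>job := (job ?S)(?i \<mapsto> (G (iterate ?S ?k) (s t), ?k))\<rparr>"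
        using less iter by (simp add: process_message_def)
      also have "\<dots> = (U s t)\<lparr>job := jobs_of G s (iterate (U s t)) (pending (Z (Suc t)))\<rparr>"
        unfolding Suc by (simp add: Z' jobs_of_def fun_eq_iff)
      finally show ?thesis by (simp only: U')
    next
      case (Some m)
      obtain u \<iota> where m: "pending (Z t) ?i = Some (u, \<iota>)" using Some by (cases m) auto
      have jobi: "job ?S ?i = Some (G (iterate (U s t) \<iota>) (s u), \<iota>)"
        by (simp add: job jobs_of_def m)
      show ?thesis
      proof (cases "?k - \<iota> < R")
        case False
        then have Z': "Z (Suc t) = (Z t)\<lparr>pending := (pending (Z t))(?i := None)\<rparr>"
          using less m by (simp add: Z_Suc schedule_message_def)
        then have U': "U s (Suc t) = U s t" by (simp add: U_def)
        have "run G x0 R \<eta> \<beta> K worker s (Suc t) = ?S\<lparr>job := (job ?S)(?i := None)\<rparr>"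
          using less iter jobi False by (simp add: process_message_def)
        also have "\<dots> = (U s t)\<lparr>job := jobs_of G s (iterate (U s t)) (pending (Z (Suc t)))\<rparr>"
          unfolding Suc by (simp add: Z' jobs_of_def fun_eq_iff)
        finally show ?thesis by (simp only: U')
      next
        case True
        have Z': "Z (Suc t) = (Z t)\<lparr>pending := (pending (Z t))(?i := None), accepted := Suc ?k,
            sample := (sample (Z t))(?k := u), version := (version (Z t))(?k := \<iota>)\<rparr>"
          using less m True by (simp add: Z_Suc schedule_message_def Let_def)
        have U': "U s (Suc t) = server_update \<eta> \<beta> (G (iterate (U s t) \<iota>) (s u)) (U s t)"
        proof -
          have "accepted_updates G x0 \<eta> \<beta> ((sample (Z t))(?k := u)) ((version (Z t))(?k := \<iota>)) s ?k
              = U s t" unfolding U_def by (rule accepted_updates_cong) auto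
          then show ?thesis unfolding U_def by (simp add: Z' Let_def)
        qed
        have kept: "iterate (U s (Suc t)) j = iterate (U s t) j" if "j \<le> ?k" for j
          using that unfolding U' by (simp add: iterate_server_update U_def iter_accepted_updates)
        have jobs: "jobs_of G s (iterate (U s (Suc t))) ((pending (Z t))(?i := None))
            = (jobs_of G s (iterate (U s t)) (pending (Z t)))(?i := None)"
          using valid kept by (auto simp: jobs_of_def fun_eq_iff valid_schedule_def intro!: option.map_cong)
        have "run G x0 R \<eta> \<beta> K worker s (Suc t)
            = server_update \<eta> \<beta> (G (iterate (U s t) \<iota>) (s u)) (?S\<lparr>job := (job ?S)(?i := None)\<rparr>)"
          using less iter jobi True by (simp add: process_message_def)
        also have "\<dots> = (U s (Suc t))\<lparr>job := (jobs_of G s (iterate (U s t)) (pending (Z t)))(?i := None)\<rparr>"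
          unfolding Suc U' by (simp add: server_update_job)
        also have "(jobs_of G s (iterate (U s t)) (pending (Z t)))(?i := None)
            = jobs_of G s (iterate (U s (Suc t))) ((pending (Z t))(?i := None))"
          by (rule jobs[symmetric])
        also have "(pending (Z t))(?i := None) = pending (Z (Suc t))" by (simp add: Z')
        finally show ?thesis .
      qed
    qed
  qed
qed

text \<open>
  The number of accepted updates after \<open>T\<close> messages is the same for all samples, so the stopping
  time of the run is a constant, and the schedule at that time describes every run.
\<close>

lemma iterate_final_state:
  assumes "\<And>t. worker t \<in> {1..n}" "0 < R"
  obtains \<tau> \<iota> where "inj_on \<tau> {..<K}" "\<And>k. k < K \<Longrightarrow> \<iota> k \<le> k \<and> k - \<iota> k < R"
    "\<And>s. iterate (final_state G x0 R \<eta> \<beta> K worker s) = iterate (accepted_updates G x0 \<eta> \<beta> \<tau> \<iota> s K)"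
proof -
  let ?Z = "schedule_run R K worker"
  define T where "T = (LEAST T. accepted (?Z T) = K)"
  have iter: "iter (run G x0 R \<eta> \<beta> K worker s t) = accepted (?Z t)" for s t
    by (simp add: run_eq_accepted_updates iter_accepted_updates)
  have "\<exists>t. iter (run G x0 R \<eta> \<beta> K worker s t) = K" for s
    using assms by (rule run_terminates)
  then have "\<exists>t. accepted (?Z t) = K" unfolding iter by blast
  then have T: "accepted (?Z T) = K" unfolding T_def by (rule LeastI_ex)
  have "iterate (final_state G x0 R \<eta> \<beta> K worker s)
      = iterate (accepted_updates G x0 \<eta> \<beta> (sample (?Z T)) (version (?Z T)) s K)" for s
    unfolding final_state_def iter T_def[symmetric] by (simp add: run_eq_accepted_updates T)
  with valid_schedule_run[of R T K worker] T show ?thesis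
    by (intro that[of "sample (?Z T)" "version (?Z T)"]) (auto simp: valid_schedule_def)
qed

section \<open>Moments of the averaged noise\<close>

text \<open>
  One martingale increment: \<open>norm_add_powr_le\<close> is integrated with \<open>a\<close> fixed, and its linear term
  has mean \<open>0\<close>.
\<close>

lemma nn_integral_norm_add_powr_le:
  fixes b :: "'s \<Rightarrow> 'a::euclidean_space"
  assumes "prob_space M" "1 < p" "p \<le> 2"
    and b: "has_bochner_integral M b 0"
    and moment: "(\<integral>\<^sup>+\<xi>. ennreal (norm (b \<xi>) powr p) \<partial>M) \<le> ennreal c" and "0 \<le> c"
  shows "(\<integral>\<^sup>+\<xi>. ennreal (norm (a + b \<xi>) powr p) \<partial>M) \<le> ennreal (norm a powr p + 2 * c)"
proof -
  interpret prob_space M by fact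
  have [measurable]: "b \<in> borel_measurable M" using b by (auto simp: has_bochner_integral_iff)
  have int: "integrable M (\<lambda>\<xi>. norm (b \<xi>) powr p)"
    using moment by (intro integrableI_bounded) (auto simp: le_less_trans)
  have le: "(LINT \<xi>|M. norm (b \<xi>) powr p) \<le> c"
    using moment int \<open>0 \<le> c\<close> by (simp add: nn_integral_eq_integral)
  let ?u = "p * norm a powr (p - 2)"
  have "has_bochner_integral M (\<lambda>\<xi>. a \<bullet> b \<xi>) (a \<bullet> 0)"
    using b by (rule has_bochner_integral_inner_right)
  then have inner: "integrable M (\<lambda>\<xi>. a \<bullet> b \<xi>)" "(LINT \<xi>|M. a \<bullet> b \<xi>) = 0"
    by (auto simp: has_bochner_integral_iff)
  have bound: "norm (a + b \<xi>) powr p \<le> norm a powr p + ?u * (a \<bullet> b \<xi>) + 2 * norm (b \<xi>) powr p" for \<xi>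
    using norm_add_powr_le[of p a "b \<xi>"] assms by simp
  have "(\<integral>\<^sup>+\<xi>. ennreal (norm (a + b \<xi>) powr p) \<partial>M)
      \<le> (\<integral>\<^sup>+\<xi>. ennreal (norm a powr p + ?u * (a \<bullet> b \<xi>) + 2 * norm (b \<xi>) powr p) \<partial>M)"
    by (intro nn_integral_mono ennreal_leI bound)
  also have "\<dots> = ennreal (LINT \<xi>|M. norm a powr p + ?u * (a \<bullet> b \<xi>) + 2 * norm (b \<xi>) powr p)"
    using int inner by (intro nn_integral_eq_integral AE_I2 order_trans[OF _ bound]) auto
  also have "(LINT \<xi>|M. norm a powr p + ?u * (a \<bullet> b \<xi>) + 2 * norm (b \<xi>) powr p)
      = norm a powr p + 2 * (LINT \<xi>|M. norm (b \<xi>) powr p)"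
    using int inner by (simp add: prob_space)
  also have "ennreal \<dots> \<le> ennreal (norm a powr p + 2 * c)"
    using le by (intro ennreal_leI) simp
  finally show ?thesis .
qed

text \<open>
  Jensen's inequality for \<open>t \<mapsto> t powr p\<close>, read off from the tangent of that function at \<open>c\<close>.
\<close>

lemma (in prob_space) expectation_le_of_powr_moment:
  assumes [measurable]: "Y \<in> borel_measurable M" and "\<And>\<omega>. 0 \<le> Y \<omega>"
    and "1 < p" "0 < c"
    and moment: "(\<integral>\<^sup>+\<omega>. ennreal (Y \<omega> powr p) \<partial>M) \<le> ennreal (c powr p)"
  shows "integrable M Y" "expectation Y \<le> c"
proof -
  have int: "integrable M (\<lambda>\<omega>. Y \<omega> powr p)"
    using moment by (intro integrableI_bounded) (auto simp: le_less_trans)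
  have le: "expectation (\<lambda>\<omega>. Y \<omega> powr p) \<le> c powr p"
    using moment int by (simp add: nn_integral_eq_integral)
  define d where "d = p * c powr (p - 1)"
  have "0 < d" using assms by (simp add: d_def)
  have dc: "c powr p + (p - 1) * c powr p = d * c"
    using powr_add[of c "p - 1" 1] assms by (simp add: d_def algebra_simps)
  have tangent: "Y \<omega> \<le> (Y \<omega> powr p + (p - 1) * c powr p) / d" for \<omega>
    using powr_tangent_convex[of p "Y \<omega>" c] assms \<open>0 < d\<close> by (simp add: d_def field_simps)
  have int': "integrable M (\<lambda>\<omega>. (Y \<omega> powr p + (p - 1) * c powr p) / d)"
    using int by simp
  show "integrable M Y"
    by (rule Bochner_Integration.integrable_bound[OF int']) (use tangent assms \<open>0 < d\<close> in auto)
  then have "expectation Y \<le> expectation (\<lambda>\<omega>. (Y \<omega> powr p + (p - 1) * c powr p) / d)"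
    by (intro integral_mono int' tangent)
  also have "\<dots> = (expectation (\<lambda>\<omega>. Y \<omega> powr p) + (p - 1) * c powr p) / d"
    using int by (simp add: prob_space)
  also have "\<dots> \<le> (c powr p + (p - 1) * c powr p) / d"
    using le \<open>0 < d\<close> by (intro divide_right_mono) auto
  also have "\<dots> = c" using \<open>0 < d\<close> by (simp add: dc)
  finally show "expectation Y \<le> c" .
qed

text \<open>
  Redrawing one of any number of independent samples does not change the law.  This replaces
  conditioning on all the other samples.
\<close>

lemma nn_integral_resample_coordinate:
  fixes h :: "('i \<Rightarrow> 's) \<Rightarrow> ennreal"
  assumes "prob_space D" and [measurable]: "h \<in> borel_measurable (\<Pi>\<^sub>M i\<in>UNIV. D)"
  shows "(\<integral>\<^sup>+s. h s \<partial>(\<Pi>\<^sub>M i\<in>UNIV. D)) = (\<integral>\<^sup>+s. \<integral>\<^sup>+\<xi>. h (s(i := \<xi>)) \<partial>D \<partial>(\<Pi>\<^sub>M i\<in>UNIV. D))"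
proof -
  let ?P = "\<Pi>\<^sub>M i\<in>(UNIV :: 'i set). D"
  interpret D: prob_space D by fact
  interpret P: prob_space ?P using assms(1) by (intro prob_space_PiM) auto
  interpret pair_sigma_finite D ?P by standard
  have upd: "(\<lambda>(\<xi>, s). s(i := \<xi>)) \<in> D \<Otimes>\<^sub>M ?P \<rightarrow>\<^sub>M ?P"
    using measurable_compose[OF measurable_pair_swap' measurable_add_dim[of i UNIV "\<lambda>_. D"]]
    by (simp add: case_prod_beta)
  have "?P = distr (D \<Otimes>\<^sub>M ?P) ?P (\<lambda>(\<xi>, s). s(i := \<xi>))"
    using distr_pair_PiM_eq_PiM[of UNIV "\<lambda>_. D" i] assms(1) by simp
  then have "(\<integral>\<^sup>+s. h s \<partial>?P) = (\<integral>\<^sup>+s. h s \<partial>distr (D \<Otimes>\<^sub>M ?P) ?P (\<lambda>(\<xi>, s). s(i := \<xi>)))"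
    by simp
  also have "\<dots> = (\<integral>\<^sup>+z. h (case z of (\<xi>, s) \<Rightarrow> s(i := \<xi>)) \<partial>(D \<Otimes>\<^sub>M ?P))"
    using upd by (intro nn_integral_distr) auto
  also have "\<dots> = (\<integral>\<^sup>+s. \<integral>\<^sup>+\<xi>. h (s(i := \<xi>)) \<partial>D \<partial>?P)"
    using nn_integral_snd[of "\<lambda>z. h (case z of (\<xi>, s) \<Rightarrow> s(i := \<xi>))"] upd by simp
  finally show ?thesis .
qed

text \<open>
  The server's recursion driven by independent samples, with a fixed order of acceptance.  The
  conditions on \<open>\<tau>\<close> and \<open>\<iota>\<close> are those that a schedule guarantees.
\<close>

locale delayed_momentum_run = smooth_objective f gradf L + D: prob_space D
  for f :: "'a::euclidean_space \<Rightarrow> real" and gradf L and D :: "'s measure" +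
  fixes G :: "'a \<Rightarrow> 's \<Rightarrow> 'a" and p \<sigma> \<alpha> \<eta> :: real and x0 :: 'a
    and \<tau> \<iota> :: "nat \<Rightarrow> nat" and K R :: nat
  assumes G_measurable: "case_prod G \<in> borel_measurable (borel \<Otimes>\<^sub>M D)"
    and p: "1 < p" "p \<le> 2"
    and unbiased: "has_bochner_integral D (G x) (gradf x)"
    and noise: "(\<integral>\<^sup>+\<xi>. ennreal (norm (G x \<xi> - gradf x) powr p) \<partial>D) \<le> ennreal (\<sigma> powr p)"
    and \<alpha>: "0 < \<alpha>" "\<alpha> \<le> 1" and \<eta>: "0 < \<eta>"
    and distinct_samples: "inj_on \<tau> {..<K}"
    and delay: "k < K \<Longrightarrow> \<iota> k \<le> k \<and> k - \<iota> k < R"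
begin

abbreviation samples :: "(nat \<Rightarrow> 's) measure" where
  "samples \<equiv> \<Pi>\<^sub>M t\<in>(UNIV :: nat set). D"

abbreviation server :: "(nat \<Rightarrow> 's) \<Rightarrow> nat \<Rightarrow> 'a state" where
  "server \<equiv> accepted_updates G x0 \<eta> (1 - \<alpha>) \<tau> \<iota>"

definition x :: "(nat \<Rightarrow> 's) \<Rightarrow> nat \<Rightarrow> 'a" where
  "x s k = iterate (server s k) k"

definition accepted_gradient :: "(nat \<Rightarrow> 's) \<Rightarrow> nat \<Rightarrow> 'a" where
  "accepted_gradient s k = G (iterate (server s k) (\<iota> k)) (s (\<tau> k))"

definition gradient_noise :: "(nat \<Rightarrow> 's) \<Rightarrow> nat \<Rightarrow> 'a" where
  "gradient_noise s k = accepted_gradient s k - gradf (x s (\<iota> k))"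

abbreviation averaged_noise :: "(nat \<Rightarrow> 's) \<Rightarrow> nat \<Rightarrow> 'a" where
  "averaged_noise s \<equiv> momentum_of (1 - \<alpha>) (gradient_noise s)"

sublocale P: prob_space samples
  using D.prob_space_axioms by (intro prob_space_PiM) auto

lemma momentum_server: "momentum (server s k) = momentum_of (1 - \<alpha>) (accepted_gradient s) k"
  by (induction k) (simp_all add: initial_state_def server_update_def Let_def accepted_gradient_def
    iter_accepted_updates)

lemma x_0: "x s 0 = x0"
  by (simp add: x_def initial_state_def)

lemma x_Suc: "x s (Suc k) = x s k - \<eta> *\<^sub>R sgn (momentum_of (1 - \<alpha>) (accepted_gradient s) (Suc k))"
  unfolding momentum_server[symmetric]
  by (simp add: x_def Let_def server_update_def iter_accepted_updates sgn_div_norm)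

lemma x_step: "norm (x s (Suc k) - x s k) \<le> \<eta>"
  unfolding x_Suc using \<eta> by (simp add: norm_sgn)

lemma iterate_server: "j \<le> k \<Longrightarrow> iterate (server s k) j = x s j"
  unfolding x_def by (rule iterate_accepted_updates)

lemma iterate_server_initial: "k < j \<Longrightarrow> iterate (server s k) j = x0"
  by (induction k) (auto simp: initial_state_def server_update_def Let_def iter_accepted_updates)

lemma norm_gradient_x_le: "norm (gradf (x s k)) \<le> norm (gradf x0) + L * \<eta> * real k"
  using gradient_drift[of "x s" \<eta> 0 k] x_step
    norm_triangle_sub[of "gradf (x s k)" "gradf x0"]
  by (simp add: x_0 norm_minus_commute)

lemma measurable_gradf [measurable]: "gradf \<in> borel_measurable borel"
proof -
  have "continuous_on UNIV gradf"
    using smooth L_pos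
    by (intro lipschitz_on_continuous_on[of L] lipschitz_onI) (auto simp: dist_norm)
  then show ?thesis by (rule borel_measurable_continuous_onI)
qed

lemma measurable_G:
  assumes "g \<in> borel_measurable M" "h \<in> M \<rightarrow>\<^sub>M D"
  shows "(\<lambda>\<omega>. G (g \<omega>) (h \<omega>)) \<in> borel_measurable M"
  using measurable_compose[OF measurable_Pair[OF assms] G_measurable] by simp

lemma measurable_server:
  "(\<lambda>s. iterate (server s k) j) \<in> borel_measurable samples"
  "(\<lambda>s. momentum (server s k)) \<in> borel_measurable samples"
proof (induction k arbitrary: j)
  case 0
  show "(\<lambda>s. iterate (server s 0) j) \<in> borel_measurable samples" for j
    by (simp add: initial_state_def)
  show "(\<lambda>s. momentum (server s 0)) \<in> borel_measurable samples"
    by (simp add: initial_state_def)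
next
  case (Suc k)
  note [measurable] = Suc
  have [measurable]: "(\<lambda>s. G (iterate (server s k) (\<iota> k)) (s (\<tau> k))) \<in> borel_measurable samples"
    by (intro measurable_G Suc measurable_component_singleton) simp
  show m [measurable]: "(\<lambda>s. momentum (server s (Suc k))) \<in> borel_measurable samples"
    by (simp add: server_update_def Let_def iter_accepted_updates)
  show "(\<lambda>s. iterate (server s (Suc k)) j) \<in> borel_measurable samples" for j
  proof (cases "j = Suc k")
    case True
    have "iterate (server s (Suc k)) j
        = iterate (server s k) k - \<eta> *\<^sub>R (momentum (server s (Suc k)) /\<^sub>R norm (momentum (server s (Suc k))))" for s
      using True by (simp add: server_update_def Let_def iter_accepted_updates)
    then show ?thesis by (simp only:) measurable
  next
    case False
    then have "iterate (server s (Suc k)) j = iterate (server s k) j" for s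
      by (simp add: server_update_def Let_def iter_accepted_updates)
    then show ?thesis by simp
  qed
qed

lemma measurable_x [measurable]: "(\<lambda>s. x s k) \<in> borel_measurable samples"
  unfolding x_def by (rule measurable_server)

lemma measurable_gradient_noise [measurable]: "(\<lambda>s. gradient_noise s k) \<in> borel_measurable samples"
  unfolding gradient_noise_def accepted_gradient_def
  by (intro borel_measurable_diff measurable_G measurable_server measurable_component_singleton
    measurable_compose[OF measurable_x measurable_gradf]) simp

lemma measurable_averaged_noise [measurable]:
  "(\<lambda>s. averaged_noise s k) \<in> borel_measurable samples"
  by (induction k) auto

text \<open>
  In the order of arrival, the noise is a sequence of martingale differences: when the update \<open>k\<close>
  is made, the state of the server and the stale iterate \<open>x s (\<iota> k)\<close> depend only on the samples
  accepted before, and these do not include the sample \<open>\<tau> k\<close>, no matter how early that one was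
  drawn.  The following lemmas express this by redrawing the sample \<open>\<tau> k\<close>.
\<close>

lemma server_resample:
  assumes "j \<le> k" "k < K"
  shows "server (s(\<tau> k := \<xi>)) j = server s j"
proof (rule accepted_updates_cong)
  fix i assume "i < j"
  then have "\<tau> i \<noteq> \<tau> k" using inj_onD[OF distinct_samples, of i k] assms by auto
  then show "(s(\<tau> k := \<xi>)) (\<tau> i) = s (\<tau> i)" by simp
qed simp

lemma x_resample: "j \<le> k \<Longrightarrow> k < K \<Longrightarrow> x (s(\<tau> k := \<xi>)) j = x s j"
  by (simp add: x_def server_resample)

lemma averaged_noise_resample:
  assumes "k < K"
  shows "averaged_noise (s(\<tau> k := \<xi>)) k = averaged_noise s k"
proof (rule momentum_of_cong)
  fix j assume "j < k"
  then have "\<tau> j \<noteq> \<tau> k" using inj_onD[OF distinct_samples, of j k] assms by auto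
  moreover have "\<iota> j \<le> j" using delay[of j] \<open>j < k\<close> assms by simp
  ultimately show "gradient_noise (s(\<tau> k := \<xi>)) j = gradient_noise s j"
    using \<open>j < k\<close> assms
    by (simp add: gradient_noise_def accepted_gradient_def x_resample server_resample)
qed

lemma gradient_noise_resample:
  assumes "k < K"
  shows "gradient_noise (s(\<tau> k := \<xi>)) k = G (x s (\<iota> k)) \<xi> - gradf (x s (\<iota> k))"
  using delay[OF assms] assms
  by (simp add: gradient_noise_def accepted_gradient_def x_resample server_resample iterate_server)

text \<open>
  Each round multiplies the moment by at most \<open>1 - \<alpha>\<close>, because \<open>(1 - \<alpha>) powr p \<le> 1 - \<alpha>\<close>, and adds
  \<open>2 * \<alpha> powr p * \<sigma> powr p\<close>; the bound is the fixed point of this recursion.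
\<close>

lemma averaged_noise_moment:
  assumes "k \<le> K"
  shows "(\<integral>\<^sup>+s. ennreal (norm (averaged_noise s k) powr p) \<partial>samples)
    \<le> ennreal (2 * \<alpha> powr (p - 1) * \<sigma> powr p)"
  using assms
proof (induction k)
  case 0
  show ?case by simp
next
  case (Suc k)
  define c where "c = (if k \<le> 1 then 0 else 1 - \<alpha>)"
  have c: "0 \<le> c" "c powr p \<le> 1 - \<alpha>"
    using \<alpha> p powr_mono'[of 1 p "1 - \<alpha>"] by (auto simp: c_def)
  let ?E = "2 * \<alpha> powr (p - 1) * \<sigma> powr p"
  let ?e = "\<lambda>s \<xi>. \<alpha> *\<^sub>R (G (x s (\<iota> k)) \<xi> - gradf (x s (\<iota> k)))"
  have "has_bochner_integral D (?e s) (\<alpha> *\<^sub>R (gradf (x s (\<iota> k)) - gradf (x s (\<iota> k))))" for s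
    by (intro has_bochner_integral_scaleR_right has_bochner_integral_diff unbiased)
       (simp add: has_bochner_integral_iff D.prob_space)
  then have mean: "has_bochner_integral D (?e s) 0" for s by simp
  have moment: "(\<integral>\<^sup>+\<xi>. ennreal (norm (?e s \<xi>) powr p) \<partial>D) \<le> ennreal (\<alpha> powr p * \<sigma> powr p)" for s
  proof -
    have [measurable]: "G y \<in> borel_measurable D" for y
      using unbiased[of y] by (auto simp: has_bochner_integral_iff)
    have "(\<integral>\<^sup>+\<xi>. ennreal (norm (?e s \<xi>) powr p) \<partial>D)
        = ennreal (\<alpha> powr p) * (\<integral>\<^sup>+\<xi>. ennreal (norm (G (x s (\<iota> k)) \<xi> - gradf (x s (\<iota> k))) powr p) \<partial>D)"
      using \<alpha> by (subst nn_integral_cmult[symmetric]) (auto simp: powr_mult ennreal_mult)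
    also have "\<dots> \<le> ennreal (\<alpha> powr p) * ennreal (\<sigma> powr p)" by (intro mult_left_mono noise) simp
    finally show ?thesis by (simp add: ennreal_mult)
  qed
  have affine: "ennreal a * ennreal b + ennreal d = ennreal (a * b + d)"
    if "0 \<le> a" "0 \<le> b" "0 \<le> d" for a b d :: real
    using that by (simp add: ennreal_mult)
  have "(\<integral>\<^sup>+s. ennreal (norm (averaged_noise s (Suc k)) powr p) \<partial>samples)
      = (\<integral>\<^sup>+s. \<integral>\<^sup>+\<xi>. ennreal (norm (averaged_noise (s(\<tau> k := \<xi>)) (Suc k)) powr p) \<partial>D \<partial>samples)"
    by (rule nn_integral_resample_coordinate[OF D.prob_space_axioms]) measurable
  also have "\<dots> = (\<integral>\<^sup>+s. \<integral>\<^sup>+\<xi>. ennreal (norm (c *\<^sub>R averaged_noise s k + ?e s \<xi>) powr p) \<partial>D \<partial>samples)"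
    using Suc.prems by (simp add: c_def averaged_noise_resample gradient_noise_resample)
  also have "\<dots> \<le> (\<integral>\<^sup>+s. ennreal (norm (c *\<^sub>R averaged_noise s k) powr p + 2 * (\<alpha> powr p * \<sigma> powr p)) \<partial>samples)"
    by (intro nn_integral_mono nn_integral_norm_add_powr_le D.prob_space_axioms p mean moment) simp
  also have "\<dots> \<le> (\<integral>\<^sup>+s. ennreal (1 - \<alpha>) * ennreal (norm (averaged_noise s k) powr p)
      + ennreal (2 * (\<alpha> powr p * \<sigma> powr p)) \<partial>samples)"
  proof (rule nn_integral_mono)
    fix s
    have "norm (c *\<^sub>R averaged_noise s k) powr p = c powr p * norm (averaged_noise s k) powr p"
      using c by (simp add: powr_mult)
    also have "\<dots> \<le> (1 - \<alpha>) * norm (averaged_noise s k) powr p"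
      using c by (intro mult_right_mono) auto
    finally show "ennreal (norm (c *\<^sub>R averaged_noise s k) powr p + 2 * (\<alpha> powr p * \<sigma> powr p))
        \<le> ennreal (1 - \<alpha>) * ennreal (norm (averaged_noise s k) powr p) + ennreal (2 * (\<alpha> powr p * \<sigma> powr p))"
      using \<alpha> by (subst affine) (auto intro!: ennreal_leI)
  qed
  also have "\<dots> = ennreal (1 - \<alpha>) * (\<integral>\<^sup>+s. ennreal (norm (averaged_noise s k) powr p) \<partial>samples)
      + ennreal (2 * (\<alpha> powr p * \<sigma> powr p))"
    by (simp add: nn_integral_add nn_integral_cmult P.emeasure_space_1)
  also have "\<dots> \<le> ennreal (1 - \<alpha>) * ennreal ?E + ennreal (2 * (\<alpha> powr p * \<sigma> powr p))"
    using Suc by (intro add_right_mono mult_left_mono) auto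
  also have "\<dots> = ennreal ((1 - \<alpha>) * ?E + 2 * (\<alpha> powr p * \<sigma> powr p))"
    using \<alpha> by (intro affine) auto
  also have "(1 - \<alpha>) * ?E + 2 * (\<alpha> powr p * \<sigma> powr p) = ?E"
  proof -
    have "\<alpha> powr p = \<alpha> * \<alpha> powr (p - 1)"
      using powr_add[of \<alpha> 1 "p - 1"] \<alpha> by simp
    then show ?thesis by (simp only:) (simp add: algebra_simps)
  qed
  finally show ?case .
qed

lemma sum_expected_gradient_norms_le:
  fixes c :: real
  assumes small_noise: "2 * \<alpha> powr (p - 1) * \<sigma> powr p \<le> c powr p" and "0 < c"
  shows "\<eta> * (\<Sum>k<K. P.expectation (\<lambda>s. norm (gradf (x s k))))
    \<le> (f x0 - (INF y. f y)) + 2 * \<eta> * (K * c) + 2 * \<eta> * norm (gradf x0) / \<alpha>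
      + K * (2 * \<eta> * (L * \<eta> * (real R - 1) + L * \<eta> * (1 - \<alpha>) / \<alpha>) + L / 2 * \<eta>^2)"
proof -
  let ?g = "\<lambda>s k. norm (gradf (x s k))"
  define N where "N s k = norm (averaged_noise s (Suc k))" for s k
  let ?C = "2 * \<eta> * norm (gradf x0) / \<alpha>
      + K * (2 * \<eta> * (L * \<eta> * (real R - 1) + L * \<eta> * (1 - \<alpha>) / \<alpha>) + L / 2 * \<eta>^2)"
  have int_g: "integrable samples (\<lambda>s. ?g s k)" for k
    by (rule P.integrable_const_bound[where B = "norm (gradf x0) + L * \<eta> * real k"])
       (auto intro: norm_gradient_x_le)
  have N: "integrable samples (\<lambda>s. N s k)" "P.expectation (\<lambda>s. N s k) \<le> c" if "k < K" for k
  proof -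
    have [measurable]: "(\<lambda>s. N s k) \<in> borel_measurable samples"
      unfolding N_def by (rule measurable_compose[OF measurable_averaged_noise borel_measurable_norm])
    have "(\<integral>\<^sup>+s. ennreal (N s k powr p) \<partial>samples) \<le> ennreal (2 * \<alpha> powr (p - 1) * \<sigma> powr p)"
      unfolding N_def using that by (intro averaged_noise_moment) simp
    also have "\<dots> \<le> ennreal (c powr p)" using small_noise by (rule ennreal_leI)
    finally have moment: "(\<integral>\<^sup>+s. ennreal (N s k powr p) \<partial>samples) \<le> ennreal (c powr p)" .
    have nonneg: "0 \<le> N s k" for s by (simp add: N_def)
    show "integrable samples (\<lambda>s. N s k)" "P.expectation (\<lambda>s. N s k) \<le> c"
      by (rule P.expectation_le_of_powr_moment[OF _ nonneg p(1) \<open>0 < c\<close> moment]; measurable)+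
  qed
  have int_N: "integrable samples (\<lambda>s. \<Sum>k<K. N s k)"
    using N by (intro Bochner_Integration.integrable_sum) auto
  have sum_N: "P.expectation (\<lambda>s. \<Sum>k<K. N s k) = (\<Sum>k<K. P.expectation (\<lambda>s. N s k))"
    using N by (intro Bochner_Integration.integral_sum) auto
  have pathwise: "\<eta> * (\<Sum>k<K. ?g s k) \<le> (f x0 - (INF y. f y)) + 2 * \<eta> * (\<Sum>k<K. N s k) + ?C" for s
  proof -
    have "accepted_gradient s = (\<lambda>j. gradf (x s (\<iota> j)) + gradient_noise s j)"
      by (simp add: gradient_noise_def)
    then show ?thesis
      using sum_gradient_norms_le[of "x s" \<eta> \<alpha> \<iota> "gradient_noise s" K R] x_Suc \<alpha> \<eta> delay
      unfolding N_def x_0 by auto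
  qed
  have "\<eta> * (\<Sum>k<K. P.expectation (\<lambda>s. ?g s k)) = P.expectation (\<lambda>s. \<eta> * (\<Sum>k<K. ?g s k))"
    using int_g by simp
  also have "\<dots> \<le> P.expectation (\<lambda>s. (f x0 - (INF y. f y)) + 2 * \<eta> * (\<Sum>k<K. N s k) + ?C)"
    using int_g int_N by (intro integral_mono pathwise) auto
  also have "\<dots> = (f x0 - (INF y. f y)) + 2 * \<eta> * (\<Sum>k<K. P.expectation (\<lambda>s. N s k)) + ?C"
    using int_N sum_N by (simp add: P.prob_space)
  also have "(\<Sum>k<K. P.expectation (\<lambda>s. N s k)) \<le> (\<Sum>k<K. c)"
    using N by (intro sum_mono) simp
  finally show ?thesis using \<eta> by simp
qed

text \<open>
  The bound is uniform in the samples and in the index, which makes the gradient norm of the output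
  integrable.  Beyond \<open>K\<close>, the iterates still have their initial value \<open>x0\<close>.
\<close>

lemma norm_gradient_iterate_bounded:
  "norm (gradf (iterate (server s K) j)) \<le> norm (gradf x0) + L * \<eta> * real K"
proof (cases "j \<le> K")
  case True
  have "L * \<eta> * real j \<le> L * \<eta> * real K" using True L_pos \<eta> by (intro mult_left_mono) auto
  with norm_gradient_x_le[of s j] True show ?thesis by (simp add: iterate_server)
next
  case False
  then show ?thesis using L_pos \<eta> by (simp add: iterate_server_initial)
qed

lemma random_iterate_expectation:
  assumes "0 < K"
  defines "M \<equiv> samples \<Otimes>\<^sub>M measure_pmf (pmf_of_set {..<K})"
  shows "integrable M (\<lambda>(s, j). norm (gradf (iterate (server s K) j)))"
    and "(\<integral>(s, j). norm (gradf (iterate (server s K) j)) \<partial>M)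
      = (\<Sum>k<K. P.expectation (\<lambda>s. norm (gradf (x s k)))) / K"
proof -
  let ?U = "measure_pmf (pmf_of_set {..<K})"
  let ?h = "\<lambda>s j. norm (gradf (iterate (server s K) j))"
  interpret U: prob_space ?U by (rule measure_pmf.prob_space_axioms)
  interpret PU: pair_prob_space samples ?U by standard
  have "(\<lambda>(s, j). ?h s j) \<in> borel_measurable (samples \<Otimes>\<^sub>M count_space UNIV)"
    unfolding case_prod_beta
    by (rule measurable_compose_countable'[where I = UNIV and g = snd])
       (auto intro!: measurable_compose[OF measurable_compose[OF measurable_fst measurable_server(1)]])
  then have [measurable]: "(\<lambda>(s, j). ?h s j) \<in> borel_measurable M"
    unfolding M_def by (simp cong: measurable_cong_sets add: sets_pair_measure_cong[OF refl sets_measure_pmf_count_space])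
  show int: "integrable M (\<lambda>(s, j). ?h s j)"
    unfolding M_def
    by (rule PU.P.integrable_const_bound[where B = "norm (gradf x0) + L * \<eta> * real K"])
       (use norm_gradient_iterate_bounded \<open>(\<lambda>(s, j). ?h s j) \<in> borel_measurable M\<close> in \<open>auto simp: M_def\<close>)
  have int_x: "integrable samples (\<lambda>s. norm (gradf (x s k)))" for k
    by (rule P.integrable_const_bound[where B = "norm (gradf x0) + L * \<eta> * real k"])
       (auto intro: norm_gradient_x_le)
  have "(\<integral>(s, j). ?h s j \<partial>M) = (\<integral>s. (\<integral>j. ?h s j \<partial>?U) \<partial>samples)"
    using PU.integral_fst'[OF int[unfolded M_def]] by (simp add: M_def)
  also have "\<dots> = (\<integral>s. (\<Sum>k<K. norm (gradf (x s k))) / K \<partial>samples)"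
    using \<open>0 < K\<close> by (simp add: integral_pmf_of_set iterate_server lessThan_empty_iff)
  also have "\<dots> = (\<Sum>k<K. P.expectation (\<lambda>s. norm (gradf (x s k)))) / K"
    using int_x by simp
  finally show "(\<integral>(s, j). ?h s j \<partial>M) = (\<Sum>k<K. P.expectation (\<lambda>s. norm (gradf (x s k)))) / K" .
qed

end

section \<open>Choice of the parameters\<close>

lemma nat_ceiling_bounds:
  fixes y :: real
  assumes "0 < y"
  shows "0 < nat \<lceil>y\<rceil>" "y \<le> real (nat \<lceil>y\<rceil>)" "real (nat \<lceil>y\<rceil>) - 1 \<le> y"
proof -
  have "0 < \<lceil>y\<rceil>" using assms by simp
  then show "0 < nat \<lceil>y\<rceil>" by simp
  have "real (nat \<lceil>y\<rceil>) = of_int \<lceil>y\<rceil>" using \<open>0 < \<lceil>y\<rceil>\<close> by simp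
  then show "y \<le> real (nat \<lceil>y\<rceil>)" "real (nat \<lceil>y\<rceil>) - 1 \<le> y"
    using ceiling_correct[of y] by linarith+
qed

text \<open>
  The parameter \<open>\<alpha>\<close> is the largest number in \<open>(0, 1]\<close> for which the bound of
  \<open>averaged_noise_moment\<close> implies that the averaged noise has mean norm at most \<open>\<epsilon> / 6\<close> by
  \<open>expectation_le_of_powr_moment\<close>.
\<close>

lemma averaged_noise_level:
  fixes \<alpha> p \<sigma> \<epsilon> :: real
  assumes "1 < p" "0 \<le> \<sigma>" "0 < \<epsilon>"
    and \<alpha>: "\<alpha> = (if \<sigma> = 0 then 1
              else min 1 ((\<epsilon> / (3 * 2 powr ((p + 1) / p) * \<sigma>)) powr (p / (p - 1))))"
  shows "2 * \<alpha> powr (p - 1) * \<sigma> powr p \<le> (\<epsilon> / 6) powr p"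
proof (cases "\<sigma> = 0")
  case False
  define B where "B = \<epsilon> / (3 * 2 powr ((p + 1) / p) * \<sigma>)"
  have pos: "0 < \<sigma>" "0 < B" using False assms by (auto simp: B_def)
  have "2 powr ((p + 1) / p) = 2 * 2 powr (1 / p)"
    using powr_add[of 2 1 "1 / p"] \<open>1 < p\<close> by (simp add: add_divide_distrib)
  then have "B = (\<epsilon> / 6) / (2 powr (1 / p) * \<sigma>)" by (simp add: B_def)
  then have "B powr p = (\<epsilon> / 6) powr p / (2 * \<sigma> powr p)"
    using pos assms by (simp add: powr_divide powr_mult powr_powr)
  then have B: "2 * B powr p * \<sigma> powr p = (\<epsilon> / 6) powr p" using pos by simp
  have "0 < \<alpha>" "\<alpha> \<le> B powr (p / (p - 1))" using False pos by (auto simp: \<alpha> B_def[symmetric])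
  then have "\<alpha> powr (p - 1) \<le> (B powr (p / (p - 1))) powr (p - 1)"
    using \<open>1 < p\<close> by (intro powr_mono2) auto
  also have "\<dots> = B powr p" using \<open>1 < p\<close> by (simp add: powr_powr)
  finally have "2 * \<alpha> powr (p - 1) * \<sigma> powr p \<le> 2 * B powr p * \<sigma> powr p"
    by (intro mult_right_mono mult_left_mono) auto
  then show ?thesis by (simp add: B)
qed simp

text \<open>
  Per round, the error \<open>\<epsilon>\<close> is spent as follows: \<open>\<epsilon> / 3\<close> on the initial gap \<open>\<Delta>\<close>, \<open>\<epsilon> / 3\<close> on
  the noise, \<open>\<epsilon> / 12\<close> each on staleness and lag, and \<open>\<epsilon> / 48\<close> on the curvature.  The
  remaining \<open>7 / 48 * \<epsilon>\<close> pay for the initial bias of the momentum.  This is where \<open>\<epsilon>\<^sup>2\<close> must not be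
  much larger than \<open>L * \<Delta>\<close>: the bias amounts to \<open>1 / \<alpha>\<close> rounds, and \<open>K\<close> has to exceed
  that number sufficiently.
\<close>

lemma gradient_sum_budget:
  fixes S g L \<Delta> \<epsilon> \<alpha> \<eta> :: real and K R :: nat
  assumes \<alpha>: "0 < \<alpha>" "\<alpha> \<le> 1" and "0 < L" "0 < \<Delta>" "0 < \<epsilon>" "0 \<le> g"
    and \<eta>: "\<eta> = \<alpha> * \<epsilon> / (24 * L)"
    and R: "real R - 1 \<le> 1 / \<alpha>"
    and K: "72 * L * \<Delta> / (\<alpha> * \<epsilon>\<^sup>2) \<le> real K"
    and g: "g\<^sup>2 \<le> 2 * L * \<Delta>" and small: "\<epsilon>\<^sup>2 \<le> 8 * L * \<Delta>"
    and S: "\<eta> * S \<le> \<Delta> + 2 * \<eta> * (K * (\<epsilon> / 6)) + 2 * \<eta> * g / \<alpha>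
      + K * (2 * \<eta> * (L * \<eta> * (real R - 1) + L * \<eta> * (1 - \<alpha>) / \<alpha>) + L / 2 * \<eta>\<^sup>2)"
  shows "S \<le> K * \<epsilon>"
proof -
  have "0 < \<eta>" using assms by simp
  have L\<eta>: "L * \<eta> = \<alpha> * \<epsilon> / 24" using \<open>0 < L\<close> by (simp add: \<eta>)
  have progress: "\<Delta> \<le> \<eta> * (K * \<epsilon> / 3)"
  proof -
    have "72 * L * \<Delta> \<le> real K * (\<alpha> * \<epsilon>\<^sup>2)" using K assms by (simp add: field_simps)
    then show ?thesis using \<open>0 < L\<close> by (simp add: \<eta> field_simps power2_eq_square)
  qed
  have bias: "2 * \<eta> * g / \<alpha> \<le> \<eta> * (7 / 48 * (K * \<epsilon>))"
  proof -
    have "(g * \<epsilon>)\<^sup>2 \<le> (2 * L * \<Delta>) * (8 * L * \<Delta>)"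
      unfolding power_mult_distrib using g small assms by (intro mult_mono) auto
    also have "\<dots> = (4 * (L * \<Delta>))\<^sup>2" by (simp add: power2_eq_square)
    finally have "g * \<epsilon> \<le> 4 * (L * \<Delta>)" by (rule power2_le_imp_le) (use assms in auto)
    moreover have "72 * (L * \<Delta>) \<le> real K * \<epsilon> * (\<alpha> * \<epsilon>)"
      using K assms by (simp add: field_simps power2_eq_square)
    moreover have "0 < L * \<Delta>" using assms by simp
    ultimately have "2 * g * \<epsilon> \<le> 7 / 48 * (real K * \<epsilon> * (\<alpha> * \<epsilon>))" by linarith
    then have "2 * g \<le> 7 / 48 * (real K * \<epsilon>) * \<alpha>"
      using \<open>0 < \<epsilon>\<close> by (simp add: mult_ac)
    then have "2 * g / \<alpha> \<le> 7 / 48 * (K * \<epsilon>)" using \<alpha> by (simp add: field_simps)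
    then have "\<eta> * (2 * g / \<alpha>) \<le> \<eta> * (7 / 48 * (K * \<epsilon>))" using \<open>0 < \<eta>\<close> by (intro mult_left_mono) auto
    then show ?thesis by (simp add: mult.commute mult.left_commute)
  qed
  have "L * \<eta> * (real R - 1) \<le> L * \<eta> * (1 / \<alpha>)"
    using R \<open>0 < L\<close> \<open>0 < \<eta>\<close> by (intro mult_left_mono) auto
  then have stale: "L * \<eta> * (real R - 1) \<le> \<epsilon> / 24" using \<alpha> by (simp add: L\<eta>)
  have lag: "L * \<eta> * (1 - \<alpha>) / \<alpha> \<le> \<epsilon> / 24"
    using \<alpha> \<open>0 < \<epsilon>\<close> by (simp add: L\<eta> field_simps)
  have curvature: "L / 2 * \<eta>\<^sup>2 \<le> \<eta> * (\<epsilon> / 48)"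
  proof -
    have "L * \<eta> \<le> \<epsilon> / 24" using \<alpha> \<open>0 < \<epsilon>\<close> by (simp add: L\<eta>)
    then have "\<eta> / 2 * (L * \<eta>) \<le> \<eta> / 2 * (\<epsilon> / 24)" using \<open>0 < \<eta>\<close> by (intro mult_left_mono) auto
    then show ?thesis by (simp add: power2_eq_square mult.commute mult.left_commute)
  qed
  have "2 * \<eta> * (L * \<eta> * (real R - 1) + L * \<eta> * (1 - \<alpha>) / \<alpha>) \<le> 2 * \<eta> * (\<epsilon> / 24 + \<epsilon> / 24)"
    using stale lag \<open>0 < \<eta>\<close> by (intro mult_left_mono add_mono) auto
  then have "2 * \<eta> * (L * \<eta> * (real R - 1) + L * \<eta> * (1 - \<alpha>) / \<alpha>) + L / 2 * \<eta>\<^sup>2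
      \<le> 2 * \<eta> * (\<epsilon> / 24 + \<epsilon> / 24) + \<eta> * (\<epsilon> / 48)"
    using curvature by (rule add_mono)
  also have "\<dots> = \<eta> * (3 / 16 * \<epsilon>)" by (simp add: algebra_simps)
  finally have "K * (2 * \<eta> * (L * \<eta> * (real R - 1) + L * \<eta> * (1 - \<alpha>) / \<alpha>) + L / 2 * \<eta>\<^sup>2)
      \<le> K * (\<eta> * (3 / 16 * \<epsilon>))" by (intro mult_left_mono) auto
  with S progress bias have "\<eta> * S \<le> \<eta> * (K * \<epsilon> / 3) + 2 * \<eta> * (K * (\<epsilon> / 6))
      + \<eta> * (7 / 48 * (K * \<epsilon>)) + K * (\<eta> * (3 / 16 * \<epsilon>))" by linarith
  also have "\<dots> = \<eta> * (K * \<epsilon>)" by (simp add: algebra_simps)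
  finally show ?thesis using \<open>0 < \<eta>\<close> by simp
qed

text \<open>
  If \<open>\<epsilon>\<^sup>2\<close> is large compared with \<open>L * \<Delta>\<close>, then the gradient is small at the starting point, and the
  \<open>K\<close> steps of length \<open>\<eta>\<close> are too short for it to grow beyond \<open>\<epsilon>\<close>.
\<close>

lemma small_gradients_budget:
  fixes g L \<Delta> \<epsilon> \<alpha> \<eta> :: real
  assumes "0 < \<alpha>" "0 < L" "0 < \<epsilon>" "0 \<le> g"
    and \<eta>: "\<eta> = \<alpha> * \<epsilon> / (24 * L)"
    and K: "K - 1 \<le> 72 * L * \<Delta> / (\<alpha> * \<epsilon>\<^sup>2)"
    and g: "g\<^sup>2 \<le> 2 * L * \<Delta>" and large: "8 * L * \<Delta> < \<epsilon>\<^sup>2"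
  shows "g + L * \<eta> * (K - 1) \<le> \<epsilon>"
proof -
  have L\<eta>: "L * \<eta> = \<alpha> * \<epsilon> / 24" using \<open>0 < L\<close> by (simp add: \<eta>)
  have "g\<^sup>2 \<le> (\<epsilon> / 2)\<^sup>2" using g large by (simp add: power2_eq_square)
  then have "g \<le> \<epsilon> / 2" by (rule power2_le_imp_le) (use \<open>0 < \<epsilon>\<close> in simp)
  moreover have "L * \<eta> * (K - 1) \<le> \<alpha> * \<epsilon> / 24 * (72 * L * \<Delta> / (\<alpha> * \<epsilon>\<^sup>2))"
    unfolding L\<eta> using assms by (intro mult_left_mono K) auto
  moreover have "\<alpha> * \<epsilon> / 24 * (72 * L * \<Delta> / (\<alpha> * \<epsilon>\<^sup>2)) = 3 * L * \<Delta> / \<epsilon>"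
    using assms by (simp add: field_simps power2_eq_square)
  moreover have "3 * L * \<Delta> / \<epsilon> \<le> \<epsilon> / 2"
  proof -
    have "6 * L * \<Delta> \<le> \<epsilon>\<^sup>2" using large zero_le_power2[of \<epsilon>] by linarith
    then show ?thesis using \<open>0 < \<epsilon>\<close> by (simp add: field_simps power2_eq_square)
  qed
  ultimately show ?thesis by linarith
qed

theorem theorem1:
  fixes D :: "'s measure"
    and F :: "real ^ 'd \<Rightarrow> 's \<Rightarrow> real" and gradF :: "real ^ 'd \<Rightarrow> 's \<Rightarrow> real ^ 'd"
    and f :: "real ^ 'd \<Rightarrow> real" and gradf :: "real ^ 'd \<Rightarrow> real ^ 'd"
    and x0 :: "real ^ 'd"
    and L p \<sigma> \<epsilon> \<Delta> \<alpha> \<eta> \<beta> :: real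
    and n R K :: nat and worker :: "nat \<Rightarrow> nat"
  assumes "prob_space D"
    and objective: "\<And>x. has_bochner_integral D (F x) (f x)"
    and gradF: "\<And>x. AE \<xi> in D. GDERIV (\<lambda>y. F y \<xi>) x :> gradF x \<xi>"
    and gradF_measurable: "case_prod gradF \<in> borel_measurable (borel \<Otimes>\<^sub>M D)"
    and gradf: "\<And>x. GDERIV f x :> gradf x"
    and "0 < L"
    and smooth: "\<And>x y. norm (gradf x - gradf y) \<le> L * norm (x - y)"
    and bounded_below: "bdd_below (range f)"
    and "1 < p" "p \<le> 2" "0 \<le> \<sigma>"
    and unbiased: "\<And>x. has_bochner_integral D (gradF x) (gradf x)"
    and noise: "\<And>x. (\<integral>\<^sup>+ \<xi>. ennreal (norm (gradF x \<xi> - gradf x) powr p) \<partial>D) \<le> ennreal (\<sigma> powr p)"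
    and "\<Delta> = f x0 - (INF x. f x)" "0 < \<Delta>" "0 < \<epsilon>"
    and "\<alpha> = (if \<sigma> = 0 then 1
              else min 1 ((\<epsilon> / (3 * 2 powr ((p + 1) / p) * \<sigma>)) powr (p / (p - 1))))"
    and "R = nat \<lceil>1 / \<alpha>\<rceil>"
    and "\<eta> = \<alpha> * \<epsilon> / (24 * L)"
    and "\<beta> = 1 - \<alpha>"
    and "K = nat \<lceil>72 * L * \<Delta> / (\<alpha> * \<epsilon>\<^sup>2)\<rceil>"
    and workers: "\<And>t. worker t \<in> {1..n}"
  shows "integrable (ransgdm_space D K)
           (\<lambda>\<omega>. norm (gradf (ransgdm_output gradF x0 R \<eta> \<beta> K worker \<omega>)))
       \<and> (\<integral>\<omega>. norm (gradf (ransgdm_output gradF x0 R \<eta> \<beta> K worker \<omega>)) \<partial>ransgdm_space D K) \<le> \<epsilon>"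
proof -
  interpret D: prob_space D by fact
  interpret smooth_objective f gradf L
    using gradf \<open>0 < L\<close> smooth bounded_below by unfold_locales
  have \<alpha>: "0 < \<alpha>" "\<alpha> \<le> 1"
    using \<open>0 < \<epsilon>\<close> \<open>0 \<le> \<sigma>\<close> unfolding \<open>\<alpha> = _\<close> by auto
  then have "0 < \<eta>" using \<open>0 < L\<close> \<open>0 < \<epsilon>\<close> unfolding \<open>\<eta> = _\<close> by simp
  have R: "0 < R" "real R - 1 \<le> 1 / \<alpha>"
    using \<alpha> nat_ceiling_bounds[of "1 / \<alpha>"] unfolding \<open>R = _\<close> by auto
  have "0 < 72 * L * \<Delta> / (\<alpha> * \<epsilon>\<^sup>2)" using \<alpha> \<open>0 < L\<close> \<open>0 < \<Delta>\<close> \<open>0 < \<epsilon>\<close> by simp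
  then have K: "0 < K" "72 * L * \<Delta> / (\<alpha> * \<epsilon>\<^sup>2) \<le> real K" "real K - 1 \<le> 72 * L * \<Delta> / (\<alpha> * \<epsilon>\<^sup>2)"
    using nat_ceiling_bounds unfolding \<open>K = _\<close> by blast+
  obtain \<tau> \<iota> where schedule: "inj_on \<tau> {..<K}" "\<And>k. k < K \<Longrightarrow> \<iota> k \<le> k \<and> k - \<iota> k < R"
    "\<And>s. iterate (final_state gradF x0 R \<eta> \<beta> K worker s)
      = iterate (accepted_updates gradF x0 \<eta> \<beta> \<tau> \<iota> s K)"
    using workers R(1) by (rule iterate_final_state[of worker n R K gradF x0 \<eta> \<beta>]) (rule that)
  interpret delayed_momentum_run f gradf L D gradF p \<sigma> \<alpha> \<eta> x0 \<tau> \<iota> K R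
    using gradF_measurable \<open>1 < p\<close> \<open>p \<le> 2\<close> unbiased noise \<alpha> \<open>0 < \<eta>\<close> schedule(1,2)
    by unfold_locales
  let ?S = "\<Sum>k<K. P.expectation (\<lambda>s. norm (gradf (x s k)))"
  have \<Delta>: "f x0 - (INF y. f y) = \<Delta>" using \<open>\<Delta> = _\<close> by simp
  have g: "(norm (gradf x0))\<^sup>2 \<le> 2 * L * \<Delta>"
    using norm_gradient_sq_le[of x0] unfolding \<Delta> .
  have "?S \<le> K * \<epsilon>"
  proof (cases "\<epsilon>\<^sup>2 \<le> 8 * L * \<Delta>")
    case True
    have "2 * \<alpha> powr (p - 1) * \<sigma> powr p \<le> (\<epsilon> / 6) powr p"
      using \<open>1 < p\<close> \<open>0 \<le> \<sigma>\<close> \<open>0 < \<epsilon>\<close> \<open>\<alpha> = _\<close> by (rule averaged_noise_level)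
    from sum_expected_gradient_norms_le[OF this] \<open>0 < \<epsilon>\<close>
    show ?thesis unfolding \<Delta>
      by (intro gradient_sum_budget[OF \<alpha> \<open>0 < L\<close> \<open>0 < \<Delta>\<close> \<open>0 < \<epsilon>\<close> norm_ge_zero \<open>\<eta> = _\<close> R(2) K(2) g True]) simp
  next
    case False
    have "P.expectation (\<lambda>s. norm (gradf (x s k))) \<le> \<epsilon>" if "k < K" for k
    proof (rule P.integral_le_const)
      have "norm (gradf (x s k)) \<le> \<epsilon>" for s
      proof -
        have "norm (gradf (x s k)) \<le> norm (gradf x0) + L * \<eta> * real k" by (rule norm_gradient_x_le)
        also have "\<dots> \<le> norm (gradf x0) + L * \<eta> * (real K - 1)"
          using that \<open>0 < L\<close> \<open>0 < \<eta>\<close> by (intro add_left_mono mult_left_mono) auto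
        also have "\<dots> \<le> \<epsilon>"
          using False by (intro small_gradients_budget[OF \<alpha>(1) \<open>0 < L\<close> \<open>0 < \<epsilon>\<close> norm_ge_zero \<open>\<eta> = _\<close> K(3) g]) simp
        finally show ?thesis .
      qed
      then show "AE s in samples. norm (gradf (x s k)) \<le> \<epsilon>" by simp
      show "integrable samples (\<lambda>s. norm (gradf (x s k)))"
        by (rule P.integrable_const_bound[where B = "norm (gradf x0) + L * \<eta> * real k"])
           (auto intro: norm_gradient_x_le)
    qed
    then have "?S \<le> (\<Sum>k<K. \<epsilon>)" by (intro sum_mono) simp
    then show ?thesis by simp
  qed
  then have "?S / K \<le> \<epsilon>" using \<open>0 < K\<close> by (simp add: field_simps)
  moreover have "(\<lambda>\<omega>. norm (gradf (ransgdm_output gradF x0 R \<eta> \<beta> K worker \<omega>)))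
      = (\<lambda>(s, j). norm (gradf (iterate (server s K) j)))"
    unfolding ransgdm_output_def \<open>\<beta> = _\<close>
    by (auto simp: schedule(3)[unfolded \<open>\<beta> = _\<close>])
  ultimately show ?thesis
    using random_iterate_expectation[OF \<open>0 < K\<close>] unfolding ransgdm_space_def by simp
qed

end
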